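(* Fix delays $0<\tau_1<\dots<\tau_K$, matrices $A_0,B_k,C_k,D_{kl},B_v,D_{kv},C_{ri},B_{rki},D_{rvi},C_{vi}$ ($k,l\in\{1,2\}$, $i=1,\dots,K$) and bounded matrix-valued functions $C_{vdi}$ on $[-\tau_i,0]$; these data define both a DDF and an ODE-PDE (see context). Let $u\in L_2^p$ and $w\in L_2^m$; if some $B_{r1i}\neq0$ assume also $w\in W^{1,2}[0,\infty)^m$ with $w(s)=0$ for $s\le0$, and if some $B_{r2i}\ne0$ assume also $u\in W^{1,2}[0,\infty)^p$ with $u(s)=0$ for $s\le0$. (1) Suppose that, for the given $u,w$ and initial conditions $x_0,r_{i0}$, the functions $x,r_i,v,y,z$ satisfy the DDF. Then, for the same $u,w$ and initial conditions $x_0$ and $\phi_{i0}(s)=r_{i0}(\tau_is)$, the functions $x,v,y,z$ also satisfy the ODE-PDE with $\phi_i(t,s)=r_i(t+\tau_is)$. (2) Similarly, suppose that, for the given $u,w$ and initial conditions $x_0,\phi_{i0}$, the functions $x,v,y,\phi_i,z$ satisfy the ODE-PDE. Then $x,v,y,z$ satisfy the DDF, for the same $u,w,x_0$, with $r_i(t)=\phi_i(t,0)$ for $t\ge 0$ and $r_{i0}(s)=\phi_{i0}(s/\tau_i)$ for $s\in[-\tau_i,0]$.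
   Context: Dimensions: $x(t)\in\mathbb{R}^n$, $w(t)\in\mathbb{R}^m$, $u(t)\in\mathbb{R}^p$, $z(t)\in\mathbb{R}^q$, $y(t)\in\mathbb{R}^r$, $v(t)\in\mathbb{R}^{n_v}$, $r_i(t),\phi_i(t,s)\in\mathbb{R}^{p_i}$; matrix dimensions are the compatible ones. $W^{1,2}$ is the first-order Sobolev subspace of $L_2$. **DDF.** For given $u,w$ and initial conditions $x_0\in\mathbb{R}^n$, $r_{i0}\in W^{1,2}[-\tau_i,0]^{p_i}$ satisfying the sewing condition $$r_{i0}(0)=C_{ri}x_0+D_{rvi}\Big(\sum_{j=1}^K C_{vj} r_{j0}(-\tau_j)+\sum_{j=1}^K \int_{-\tau_j}^0C_{vdj}(s) r_{j0}(s)ds\Big),\quad i=1,\dots,K,$$ functions $x,z,y,v$ on $[0,\infty)$ and $r_i$ on $[-\tau_i,\infty)$ satisfy the DDF if $x$ is differentiable on $[0,\infty)$, $x(0)=x_0$, $r_i(s)=r_{i0}(s)$ for $s\in[-\tau_i,0]$, $r_i(t+\cdot)\in W^{1,2}[-\tau_i,0]$ for $i=1,\dots,K$, and for all $t\ge0$, $i=1,\dots,K$, $$\begin{bmatrix}\dot x(t) \\ z(t) \\ y(t) \\ r_i(t)\end{bmatrix}=\begin{bmatrix}A_0 & B_1& B_2 \\ C_1 &D_{11}&D_{12} \\ C_2&D_{21}&D_{22} \\ C_{ri}&B_{r1i}&B_{r2i}\end{bmatrix}\begin{bmatrix}x(t) \\ w(t) \\ u(t)\end{bmatrix}+\begin{bmatrix}B_v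 \\ D_{1v} \\ D_{2v} \\ D_{rvi}\end{bmatrix} v(t),$$ $$v(t)=\sum_{i=1}^K C_{vi} r_i(t-\tau_i)+\sum_{i=1}^K \int_{-\tau_i}^0C_{vdi}(s) r_i(t+s)ds.$$ **ODE-PDE.** For given $u,w$ and initial conditions $x_0\in\mathbb{R}^n$, $\phi_{i0}\in W^{1,2}[-1,0]^{p_i}$ satisfying the sewing condition $$\phi_{i0}(0)=C_{ri}x_0+D_{rvi}\Big(\sum_{j=1}^K C_{vj} \phi_{j0}(-1)+\sum_{j=1}^K \int_{-1}^0\tau_jC_{vdj}(\tau_j s) \phi_{j0}(s)ds\Big),\quad i=1,\dots,K,$$ functions $x,z,y,v$ on $[0,\infty)$ and $\phi_i(t)=\phi_i(t,\cdot)\in W^{1,2}[-1,0]^{p_i}$, $i=1,\dots,K$, satisfy the ODE-PDE if $x$ is differentiable and $\phi_i$ is Fréchet differentiable on $[0,\infty)$, $x(0)=x_0$, $\phi_i(0,s)=\phi_{i0}(s)$ for $s\in[-1,0]$, and for all $t\ge0$, $i=1,\dots,K$, $$\begin{bmatrix}\dot x(t) \\ z(t) \\ y(t) \\ \phi_i(t,0)\end{bmatrix}=\begin{bmatrix}A_0 & B_1& B_2 \\ C_1 &D_{11}&D_{12} \\ C_2&D_{21}&D_{22} \\ C_{ri}&B_{r1i}&B_{r2i}\end{bmatrix}\begin{bmatrix}x(t) \\ w(t) \\ u(t)\end{bmatrix}+\begin{bmatrix}B_v \\ D_{1v} \\ D_{2v} \\ D_{rvi}\end{bmatrix} v(t),$$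 $$\dot \phi_i(t,s)=\frac{1}{\tau_i}\partial_s\phi_i(t,s),\qquad v(t)=\sum_{i=1}^K C_{vi} \phi_i(t,-1)+\sum_{i=1}^K \int_{-1}^0\tau_iC_{vdi}(\tau_i s) \phi_i(t, s)ds.$$ In both cases, that the initial conditions meet the sewing condition is part of "satisfying" the system. *)

theory Defs
  imports "HOL-Analysis.Analysis"
begin

section \<open>Sobolev functions on a real interval\<close>

definition L2_on :: "real set \<Rightarrow> (real \<Rightarrow> real) \<Rightarrow> bool" where
  "L2_on S f \<longleftrightarrow> f \<in> borel_measurable (lebesgue_on S) \<and> integrable (lebesgue_on S) (\<lambda>s. (f s)\<^sup>2)"

text \<open>Weak derivative, tested against continuously differentiable functions with compact
  support in the interior of the interval (as in Brezis, \<^emph>\<open>Functional Analysis, Sobolev Spaces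
  and PDE\<close>, Section 8.2).\<close>

definition has_weak_deriv :: "real set \<Rightarrow> (real \<Rightarrow> real) \<Rightarrow> (real \<Rightarrow> real) \<Rightarrow> bool" where
  "has_weak_deriv S f g \<longleftrightarrow>
     (\<forall>\<psi> \<psi>'. (\<forall>s. (\<psi> has_real_derivative \<psi>' s) (at s)) \<and> continuous_on UNIV \<psi>' \<and>
             (\<exists>C. compact C \<and> C \<subseteq> interior S \<and> (\<forall>s. s \<notin> C \<longrightarrow> \<psi> s = 0)) \<longrightarrow>
       (LINT s|lebesgue_on S. f s * \<psi>' s) = - (LINT s|lebesgue_on S. g s * \<psi> s))"

text \<open>The elements of $W^{1,2}$ are evaluated at points (boundary values, delayed values), so a
  Sobolev class is represented by its continuous representative.\<close>

definition W12_on :: "real set \<Rightarrow> (real \<Rightarrow> real) \<Rightarrow> bool" where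
  "W12_on S f \<longleftrightarrow> continuous_on S f \<and> L2_on S f \<and> (\<exists>g. L2_on S g \<and> has_weak_deriv S f g)"

section \<open>Vectors whose dimension depends on the channel\<close>

text \<open>The dimensions $p_i$ vary with \<open>i\<close>, so a vector in $\mathbb{R}^{p_i}$ is a function
  \<^typ>\<open>nat \<Rightarrow> real\<close> of which only the components \<open>k < p\<^sub>i\<close> are used. A matrix with $p_i$ rows is
  given by its rows, a matrix with $p_i$ columns by its columns (with indices \<open>k < p\<^sub>i\<close>).\<close>

definition mult_rows :: "(nat \<Rightarrow> real ^ 'a) \<Rightarrow> real ^ 'a \<Rightarrow> nat \<Rightarrow> real" where
  "mult_rows M a = (\<lambda>k. M k \<bullet> a)"

definition mult_cols :: "nat \<Rightarrow> (nat \<Rightarrow> real ^ 'a) \<Rightarrow> (nat \<Rightarrow> real) \<Rightarrow> real ^ 'a" where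
  "mult_cols d M b = (\<Sum>k<d. b k *\<^sub>R M k)"

definition L2_norm :: "nat \<Rightarrow> real set \<Rightarrow> (real \<Rightarrow> nat \<Rightarrow> real) \<Rightarrow> real" where
  "L2_norm d S f = sqrt (LINT s|lebesgue_on S. (\<Sum>k<d. (f s k)\<^sup>2))"

text \<open>Frechet derivative at \<open>t\<close> of a map from $[0,\infty)$ into $L_2(S)^d$ (one-sided at \<open>t = 0\<close>); the
  linear map is \<open>h \<mapsto> h D\<close>.\<close>

definition has_L2_derivative ::
  "nat \<Rightarrow> real set \<Rightarrow> (real \<Rightarrow> real \<Rightarrow> nat \<Rightarrow> real) \<Rightarrow> (real \<Rightarrow> nat \<Rightarrow> real) \<Rightarrow> real \<Rightarrow> bool" where
  "has_L2_derivative d S \<phi> D t \<longleftrightarrow>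
     (\<forall>k<d. L2_on S (\<lambda>s. D s k)) \<and>
     ((\<lambda>t'. L2_norm d S (\<lambda>s k. \<phi> t' s k - \<phi> t s k - (t' - t) * D s k) / \<bar>t' - t\<bar>) \<longlongrightarrow> 0)
       (at t within {0..})"

section \<open>The two systems\<close>

text \<open>\<open>dimr i\<close> is $p_i$. The matrices \<open>Cr\<close>, \<open>Br1\<close>, \<open>Br2\<close>, \<open>Drv\<close> are given by rows, \<open>Cv\<close> and
  \<open>Cvd\<close> by columns. The delay index \<open>i\<close> ranges over \<open>{1..K}\<close>.\<close>

record ('n::finite, 'm::finite, 'p::finite, 'q::finite, 'r::finite, 'nv::finite) delay_data =
  K :: nat
  tau :: "nat \<Rightarrow> real"
  dimr :: "nat \<Rightarrow> nat"
  A0 :: "real ^ 'n ^ 'n"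
  B1 :: "real ^ 'm ^ 'n"
  B2 :: "real ^ 'p ^ 'n"
  Bv :: "real ^ 'nv ^ 'n"
  C1 :: "real ^ 'n ^ 'q"
  D11 :: "real ^ 'm ^ 'q"
  D12 :: "real ^ 'p ^ 'q"
  D1v :: "real ^ 'nv ^ 'q"
  C2 :: "real ^ 'n ^ 'r"
  D21 :: "real ^ 'm ^ 'r"
  D22 :: "real ^ 'p ^ 'r"
  D2v :: "real ^ 'nv ^ 'r"
  Cr :: "nat \<Rightarrow> nat \<Rightarrow> real ^ 'n"
  Br1 :: "nat \<Rightarrow> nat \<Rightarrow> real ^ 'm"
  Br2 :: "nat \<Rightarrow> nat \<Rightarrow> real ^ 'p"
  Drv :: "nat \<Rightarrow> nat \<Rightarrow> real ^ 'nv"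
  Cv :: "nat \<Rightarrow> nat \<Rightarrow> real ^ 'nv"
  Cvd :: "nat \<Rightarrow> real \<Rightarrow> nat \<Rightarrow> real ^ 'nv"

text \<open>The value of \<open>v\<close> for history segments $\rho_i$ on $[-\tau_i,0]$, respectively for states
  $\phi_i$ on $[-1,0]$.\<close>

definition ddf_delay ::
  "('n::finite, 'm::finite, 'p::finite, 'q::finite, 'r::finite, 'nv::finite) delay_data
    \<Rightarrow> (nat \<Rightarrow> real \<Rightarrow> nat \<Rightarrow> real) \<Rightarrow> real ^ 'nv" where
  "ddf_delay S \<rho> =
     (\<Sum>i=1..K S. mult_cols (dimr S i) (Cv S i) (\<rho> i (- tau S i))) +
     (\<Sum>i=1..K S. LINT s|lebesgue_on {- tau S i..0}. mult_cols (dimr S i) (Cvd S i s) (\<rho> i s))"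

definition pde_delay ::
  "('n::finite, 'm::finite, 'p::finite, 'q::finite, 'r::finite, 'nv::finite) delay_data
    \<Rightarrow> (nat \<Rightarrow> real \<Rightarrow> nat \<Rightarrow> real) \<Rightarrow> real ^ 'nv" where
  "pde_delay S \<phi> =
     (\<Sum>i=1..K S. mult_cols (dimr S i) (Cv S i) (\<phi> i (- 1))) +
     (\<Sum>i=1..K S. LINT s|lebesgue_on {- 1..0}.
        tau S i *\<^sub>R mult_cols (dimr S i) (Cvd S i (tau S i * s)) (\<phi> i s))"

text \<open>The block equation common to both systems; \<open>\<rho> i t\<close> stands for $r_i(t)$, respectively
  $\phi_i(t,0)$.\<close>

definition block_equation ::
  "('n::finite, 'm::finite, 'p::finite, 'q::finite, 'r::finite, 'nv::finite) delay_data
    \<Rightarrow> (real \<Rightarrow> real ^ 'p) \<Rightarrow> (real \<Rightarrow> real ^ 'm) \<Rightarrow> (real \<Rightarrow> real ^ 'n)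
    \<Rightarrow> (nat \<Rightarrow> real \<Rightarrow> nat \<Rightarrow> real) \<Rightarrow> (real \<Rightarrow> real ^ 'nv) \<Rightarrow> (real \<Rightarrow> real ^ 'r)
    \<Rightarrow> (real \<Rightarrow> real ^ 'q) \<Rightarrow> bool" where
  "block_equation S u w x \<rho> v y z \<longleftrightarrow>
     (\<forall>t\<ge>0.
       (x has_vector_derivative (A0 S *v x t + B1 S *v w t + B2 S *v u t + Bv S *v v t))
         (at t within {0..}) \<and>
       z t = C1 S *v x t + D11 S *v w t + D12 S *v u t + D1v S *v v t \<and>
       y t = C2 S *v x t + D21 S *v w t + D22 S *v u t + D2v S *v v t \<and>
       (\<forall>i\<in>{1..K S}. \<forall>k<dimr S i.
          \<rho> i t k = mult_rows (Cr S i) (x t) k + mult_rows (Br1 S i) (w t) k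
            + mult_rows (Br2 S i) (u t) k + mult_rows (Drv S i) (v t) k))"

text \<open>In both predicates the first conjunct contains the regularity of the initial data and the
  sewing condition.\<close>

definition satisfies_DDF ::
  "('n::finite, 'm::finite, 'p::finite, 'q::finite, 'r::finite, 'nv::finite) delay_data
    \<Rightarrow> (real \<Rightarrow> real ^ 'p) \<Rightarrow> (real \<Rightarrow> real ^ 'm)
    \<Rightarrow> real ^ 'n \<Rightarrow> (nat \<Rightarrow> real \<Rightarrow> nat \<Rightarrow> real)
    \<Rightarrow> (real \<Rightarrow> real ^ 'n) \<Rightarrow> (nat \<Rightarrow> real \<Rightarrow> nat \<Rightarrow> real) \<Rightarrow> (real \<Rightarrow> real ^ 'nv)
    \<Rightarrow> (real \<Rightarrow> real ^ 'r) \<Rightarrow> (real \<Rightarrow> real ^ 'q) \<Rightarrow> bool" where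
  "satisfies_DDF S u w x0 r0 x r v y z \<longleftrightarrow>
     (\<forall>i\<in>{1..K S}. \<forall>k<dimr S i.
        W12_on {- tau S i..0} (\<lambda>s. r0 i s k) \<and>
        r0 i 0 k = mult_rows (Cr S i) x0 k + mult_rows (Drv S i) (ddf_delay S r0) k) \<and>
     x 0 = x0 \<and>
     (\<forall>i\<in>{1..K S}. \<forall>s\<in>{- tau S i..0}. \<forall>k<dimr S i. r i s k = r0 i s k) \<and>
     (\<forall>t\<ge>0. \<forall>i\<in>{1..K S}. \<forall>k<dimr S i. W12_on {- tau S i..0} (\<lambda>s. r i (t + s) k)) \<and>
     block_equation S u w x r v y z \<and>
     (\<forall>t\<ge>0. v t = ddf_delay S (\<lambda>i s. r i (t + s)))"

text \<open>\<open>\<phi>\<^sub>i\<close> is Frechet differentiable as a map into $L_2[-1,0]^{p_i}$; hence both sides of the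
  transport equation are elements of $L_2$, and they are compared almost everywhere in \<open>s\<close> for
  every \<open>t \<ge> 0\<close>.\<close>

definition satisfies_ODE_PDE ::
  "('n::finite, 'm::finite, 'p::finite, 'q::finite, 'r::finite, 'nv::finite) delay_data
    \<Rightarrow> (real \<Rightarrow> real ^ 'p) \<Rightarrow> (real \<Rightarrow> real ^ 'm)
    \<Rightarrow> real ^ 'n \<Rightarrow> (nat \<Rightarrow> real \<Rightarrow> nat \<Rightarrow> real)
    \<Rightarrow> (real \<Rightarrow> real ^ 'n) \<Rightarrow> (nat \<Rightarrow> real \<Rightarrow> real \<Rightarrow> nat \<Rightarrow> real) \<Rightarrow> (real \<Rightarrow> real ^ 'nv)
    \<Rightarrow> (real \<Rightarrow> real ^ 'r) \<Rightarrow> (real \<Rightarrow> real ^ 'q) \<Rightarrow> bool" where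
  "satisfies_ODE_PDE S u w x0 \<phi>0 x \<phi> v y z \<longleftrightarrow>
     (\<forall>i\<in>{1..K S}. \<forall>k<dimr S i.
        W12_on {- 1..0} (\<lambda>s. \<phi>0 i s k) \<and>
        \<phi>0 i 0 k = mult_rows (Cr S i) x0 k + mult_rows (Drv S i) (pde_delay S \<phi>0) k) \<and>
     x 0 = x0 \<and>
     (\<forall>i\<in>{1..K S}. \<forall>s\<in>{- 1..0}. \<forall>k<dimr S i. \<phi> i 0 s k = \<phi>0 i s k) \<and>
     (\<forall>t\<ge>0. \<forall>i\<in>{1..K S}. \<forall>k<dimr S i. W12_on {- 1..0} (\<lambda>s. \<phi> i t s k)) \<and>
     block_equation S u w x (\<lambda>i t. \<phi> i t 0) v y z \<and>
     (\<forall>t\<ge>0. \<forall>i\<in>{1..K S}. \<exists>D G.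
        has_L2_derivative (dimr S i) {- 1..0} (\<phi> i) D t \<and>
        (\<forall>k<dimr S i. L2_on {- 1..0} (\<lambda>s. G s k) \<and>
           has_weak_deriv {- 1..0} (\<lambda>s. \<phi> i t s k) (\<lambda>s. G s k)) \<and>
        (AE s in lebesgue_on {- 1..0}. \<forall>k<dimr S i. D s k = 1 / tau S i * G s k)) \<and>
     (\<forall>t\<ge>0. v t = pde_delay S (\<lambda>i. \<phi> i t))"

end

theory Submission
  imports Defs
begin

text \<open>Both systems contain the same block equation, and the delay terms agree after an affine
  substitution, so the point is that \<open>\<phi>\<^sub>i(t,s) = r\<^sub>i(t + \<tau>\<^sub>i s)\<close> solves the transport equation in the
  $L_2$ sense and that every $L_2$ solution has this form.

  A continuous function with weak derivative $g$ is a primitive of $g$ (test with smoothed indicator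
  functions). Hence, after gluing the windows $[t-\tau_i,t]$, $r_i$ is a primitive of a locally square
  integrable function, and its difference quotients converge in $L_2$ because translations are
  $L_2$-continuous.

  Conversely, pairing $\phi_i(t,\cdot)$ with a test function that moves along the characteristics gives a
  function of $t$ with derivative zero: its derivative is the defect in the weak-derivative identity. As
  the support stays in $(-1,0)$, no boundary terms occur, and continuity in $s$ upgrades the result
  to constancy along characteristics.\<close>

section \<open>Affine substitution\<close>

text \<open>The time derivative lives in L2, so it says nothing about the traces \<phi>_i(t,0) and
  \<phi>_i(t,-1), which are just what the block equation and the delay term evaluate. Pointwise
  identities therefore come out of integrals against compactly supported tests, and end points are
  reached by continuity in s. Tests have to be once continuously differentiable, so quadratic
  splines with explicit supports suffice. The characteristics are the lines t + \<tau> s = const;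
  along them a test slides to the left at speed 1/\<tau>.

  A weak derivative, the density of a primitive and the time derivative are determined up to null
  sets and come from separate constructions; Borel representatives and spliced densities make them
  refer to one function. A transport step covers less than one full delay, as the strip of
  characteristics that stay inside -1 < s < 0 must have positive width; the value at s = -1 takes
  two half steps. The analysis is done for one scalar component; the vector statements are finite
  sums, intersections and choices over k < p_i.\<close>

lemma indicator_affine_Icc:
  "0 < c \<Longrightarrow> indicat_real {t + c * a..t + c * b} (t + c * s) = indicat_real {a..b} (s::real)"
  by (auto simp: indicator_def)

lemma integrable_affine_Icc:
  fixes f :: "real \<Rightarrow> 'a :: euclidean_space"
  assumes "0 < c"
  shows "integrable (lebesgue_on {a..b}) (\<lambda>s. f (t + c * s)) \<longleftrightarrow>
    integrable (lebesgue_on {t + c * a..t + c * b}) f"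
  using lebesgue_integrable_real_affine_iff
    [of c "\<lambda>x. indicator {t + c * a..t + c * b} x *\<^sub>R f x" t] assms
  by (simp add: integrable_restrict_space indicator_affine_Icc)

lemma integral_affine_Icc:
  fixes f :: "real \<Rightarrow> 'a :: euclidean_space"
  assumes "0 < c"
  shows "(LINT x|lebesgue_on {t + c * a..t + c * b}. f x) =
    c *\<^sub>R (LINT s|lebesgue_on {a..b}. f (t + c * s))"
  using lebesgue_integral_real_affine
    [of c "\<lambda>x. indicator {t + c * a..t + c * b} x *\<^sub>R f x" t] assms
  by (simp add: integral_restrict_space indicator_affine_Icc)

lemma borel_measurable_affine_Icc:
  fixes f :: "real \<Rightarrow> real"
  assumes "0 < c" and "f \<in> borel_measurable (lebesgue_on {t + c * a..t + c * b})"
  shows "(\<lambda>s. f (t + c * s)) \<in> borel_measurable (lebesgue_on {a..b})"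
proof -
  have "(\<lambda>x. indicator {t + c * a..t + c * b} x *\<^sub>R f x) \<in> borel_measurable lebesgue"
    using assms(2) by (subst (asm) borel_measurable_restrict_space_iff) auto
  moreover have "(\<lambda>s. t + c * s) \<in> lebesgue \<rightarrow>\<^sub>M lebesgue"
    using lebesgue_affine_measurable[of "\<lambda>_. c" t] assms(1) by simp
  ultimately have "(\<lambda>s. indicator {t + c * a..t + c * b} (t + c * s) *\<^sub>R f (t + c * s))
      \<in> borel_measurable lebesgue"
    by (rule measurable_compose_rev)
  then show ?thesis
    using assms(1) by (subst borel_measurable_restrict_space_iff) (auto simp: indicator_affine_Icc)
qed

lemma L2_on_affine_Icc:
  assumes "0 < c" and "L2_on {t + c * a..t + c * b} f"
  shows "L2_on {a..b} (\<lambda>s. f (t + c * s))"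
  using assms integrable_affine_Icc[of c a b "\<lambda>x. (f x)\<^sup>2" t]
  by (auto simp: L2_on_def intro: borel_measurable_affine_Icc)

lemma has_weak_derivD:
  assumes "has_weak_deriv S f g"
    and "\<And>s. (\<psi> has_real_derivative \<psi>' s) (at s)" "continuous_on UNIV \<psi>'"
    and "compact C" "C \<subseteq> interior S" "\<And>s. s \<notin> C \<Longrightarrow> \<psi> s = 0"
  shows "(LINT s|lebesgue_on S. f s * \<psi>' s) = - (LINT s|lebesgue_on S. g s * \<psi> s)"
  using assms(1)[unfolded has_weak_deriv_def, rule_format, of \<psi> \<psi>'] assms(2-) by auto

text \<open>A test function \<psi> for the rescaled f is pulled back to \<psi>((x - t) / c) on the
  image interval. On the left-hand side the chain rule divides by c and the substitution multiplies
  by c; on the right-hand side nothing cancels the Jacobian, and it becomes the factor of the new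
  weak derivative.\<close>

lemma has_weak_deriv_affine_Icc:
  assumes c: "0 < c" and weak: "has_weak_deriv {t + c * a..t + c * b} f g"
  shows "has_weak_deriv {a..b} (\<lambda>s. f (t + c * s)) (\<lambda>s. c * g (t + c * s))"
  unfolding has_weak_deriv_def
proof (intro allI impI, elim conjE exE)
  fix \<psi> \<psi>' :: "real \<Rightarrow> real" and C
  assume deriv: "\<forall>s. (\<psi> has_real_derivative \<psi>' s) (at s)" and cont: "continuous_on UNIV \<psi>'"
    and C: "compact C" "C \<subseteq> interior {a..b}" and supp: "\<forall>s. s \<notin> C \<longrightarrow> \<psi> s = 0"
  let ?p = "\<lambda>x. \<psi> ((x - t) / c)" and ?p' = "\<lambda>x. \<psi>' ((x - t) / c) / c"
  have "(?p has_real_derivative ?p' x) (at x)" for x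
    by (rule DERIV_chain2[where f = \<psi>, THEN DERIV_cong])
       (use deriv c in \<open>auto intro!: derivative_eq_intros\<close>)
  moreover have "continuous_on UNIV ?p'"
    by (rule continuous_on_divide[OF continuous_on_compose2[OF cont]])
       (use c in \<open>auto intro!: continuous_intros\<close>)
  moreover have "compact ((\<lambda>s. t + c * s) ` C)"
    by (intro compact_continuous_image continuous_intros C)
  moreover have "(\<lambda>s. t + c * s) ` C \<subseteq> interior {t + c * a..t + c * b}"
    using C c by auto
  moreover have "?p x = 0" if "x \<notin> (\<lambda>s. t + c * s) ` C" for x
  proof -
    have "(x - t) / c \<notin> C"
      using that c by (auto simp: image_iff)
    then show ?thesis using supp by auto
  qed
  ultimately have "(LINT x|lebesgue_on {t + c * a..t + c * b}. f x * ?p' x) =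
      - (LINT x|lebesgue_on {t + c * a..t + c * b}. g x * ?p x)"
    by (rule has_weak_derivD[OF weak])
  then show "(LINT s|lebesgue_on {a..b}. f (t + c * s) * \<psi>' s) =
      - (LINT s|lebesgue_on {a..b}. c * g (t + c * s) * \<psi> s)"
    using c by (simp add: integral_affine_Icc mult.assoc)
qed

text \<open>Used with c = \<tau>_i to pass from histories to states, with c = 1/\<tau>_i for the way
  back, and with c = 1 to move a window in time.\<close>

lemma W12_on_affine_Icc:
  assumes c: "0 < c" and f: "W12_on {t + c * a..t + c * b} f"
  shows "W12_on {a..b} (\<lambda>s. f (t + c * s))"
proof -
  obtain g where g: "L2_on {t + c * a..t + c * b} g" "has_weak_deriv {t + c * a..t + c * b} f g"
    using f by (auto simp: W12_on_def)
  have "L2_on {a..b} (\<lambda>s. c * g (t + c * s))"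
    using L2_on_affine_Icc[OF c g(1)] by (auto simp: L2_on_def power_mult_distrib)
  moreover have "continuous_on {a..b} (\<lambda>s. f (t + c * s))"
    by (rule continuous_on_compose2[of "{t + c * a..t + c * b}" f])
       (use f c in \<open>auto simp: W12_on_def intro!: continuous_intros\<close>)
  moreover have "L2_on {a..b} (\<lambda>s. f (t + c * s))"
    using f by (intro L2_on_affine_Icc c) (simp add: W12_on_def)
  ultimately show ?thesis
    using has_weak_deriv_affine_Icc[OF c g(2)] by (auto simp: W12_on_def)
qed

text \<open>The Jacobian of the scaling by \<tau>_i is the weight \<tau>_i in
  \<open>pde_delay\<close>. Agreement is asked for k < p_i and s in [-1,0], since all other values
  of the encoded vectors are arbitrary.\<close>

lemma ddf_delay_rescale:
  assumes tau: "\<forall>i\<in>{1..K S}. 0 < tau S i"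
    and eq: "\<And>i s k. i \<in> {1..K S} \<Longrightarrow> s \<in> {- 1..0} \<Longrightarrow> k < dimr S i \<Longrightarrow> \<rho> i (tau S i * s) k = \<phi> i s k"
  shows "ddf_delay S \<rho> = pde_delay S \<phi>"
proof -
  have 1: "mult_cols (dimr S i) M (\<rho> i (tau S i * s)) = mult_cols (dimr S i) M (\<phi> i s)"
    if "i \<in> {1..K S}" "s \<in> {- 1..0}" for i s and M :: "nat \<Rightarrow> real ^ 'nv"
    unfolding mult_cols_def by (intro sum.cong refl) (use eq[OF that] in auto)
  have "(LINT s|lebesgue_on {- tau S i..0}. mult_cols (dimr S i) (Cvd S i s) (\<rho> i s)) =
     (LINT s|lebesgue_on {- 1..0}. tau S i *\<^sub>R mult_cols (dimr S i) (Cvd S i (tau S i * s)) (\<phi> i s))"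
    if i: "i \<in> {1..K S}" for i
  proof -
    have "(LINT s|lebesgue_on {- tau S i..0}. mult_cols (dimr S i) (Cvd S i s) (\<rho> i s)) =
      tau S i *\<^sub>R (LINT s|lebesgue_on {- 1..0}.
        mult_cols (dimr S i) (Cvd S i (tau S i * s)) (\<rho> i (tau S i * s)))"
      using integral_affine_Icc[of "tau S i" 0 "- 1" 0] tau i by simp
    also have "\<dots> = tau S i *\<^sub>R (LINT s|lebesgue_on {- 1..0}.
        mult_cols (dimr S i) (Cvd S i (tau S i * s)) (\<phi> i s))"
      by (intro arg_cong2[where f=scaleR] refl Bochner_Integration.integral_cong) (use 1 i in auto)
    finally show ?thesis by simp
  qed
  moreover have "mult_cols (dimr S i) (Cv S i) (\<rho> i (- tau S i)) =
      mult_cols (dimr S i) (Cv S i) (\<phi> i (- 1))" if "i \<in> {1..K S}" for i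
    using 1[OF that, of "- 1"] by simp
  ultimately show ?thesis
    unfolding ddf_delay_def pde_delay_def by (simp cong: sum.cong_simp)
qed

section \<open>Weak derivatives and primitives\<close>

definition pos_sq :: "real \<Rightarrow> real" where "pos_sq x = (max 0 x)\<^sup>2"

lemma pos_sq_deriv: "(pos_sq has_real_derivative 2 * max 0 x) (at x)"
proof -
  consider "x < 0" | "x = 0" | "0 < x" by linarith
  then show ?thesis
  proof cases
    case 1
    have "((\<lambda>_. 0) has_real_derivative 2 * max 0 x) (at x)" using 1 by simp
    then show ?thesis
      by (rule has_field_derivative_transform_within_open[of _ _ _ "{..<0}"])
         (use 1 in \<open>auto simp: pos_sq_def\<close>)
  next
    case 2
    \<comment> \<open>The two branches meet at 0: the quotient is h or 0.\<close>
    have "((\<lambda>h. (pos_sq (0 + h) - pos_sq 0) / h) \<longlongrightarrow> 0) (at 0)"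
    proof (rule Lim_null_comparison)
      show "\<forall>\<^sub>F h in at 0. norm ((pos_sq (0 + h) - pos_sq 0) / h) \<le> \<bar>h\<bar>"
        by (intro always_eventually allI) (auto simp: pos_sq_def max_def power2_eq_square)
      show "((\<lambda>h::real. \<bar>h\<bar>) \<longlongrightarrow> 0) (at 0)" by (intro tendsto_eq_intros) auto
    qed
    then show ?thesis using 2 by (simp add: DERIV_def)
  next
    case 3
    have "((\<lambda>x. x\<^sup>2) has_real_derivative 2 * max 0 x) (at x)"
      using 3 by (auto intro!: derivative_eq_intros)
    then show ?thesis
      by (rule has_field_derivative_transform_within_open[of _ _ _ "{0<..}"])
         (use 3 in \<open>auto simp: pos_sq_def\<close>)
  qed
qed

text \<open>Quadratic spline rising from 0 to 1 on [0,1]. The second difference of x^2 with step 1/2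
  is the constant 1/2, which explains the factor 2 and the value 1 to the right of 1. Squared
  positive parts are the lowest truncated powers with a continuous derivative.\<close>

definition ramp :: "real \<Rightarrow> real" where
  "ramp x = 2 * (pos_sq x - 2 * pos_sq (x - 1/2) + pos_sq (x - 1))"

text \<open>The triangle on [0,1] with peak 2 at 1/2, hence of area 1: being the derivative of
  \<open>ramp\<close>, it also serves as the mollifier.\<close>

definition hat :: "real \<Rightarrow> real" where
  "hat x = 4 * (max 0 x - 2 * max 0 (x - 1/2) + max 0 (x - 1))"

lemma ramp_deriv: "(ramp has_real_derivative hat x) (at x)"
proof -
  have "((\<lambda>x. pos_sq (x - a)) has_real_derivative 2 * max 0 (x - a)) (at x)" for a
    by (rule DERIV_chain2[OF pos_sq_deriv, THEN DERIV_cong]) (auto intro!: derivative_eq_intros)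
  note * = this[of "1/2"] this[of 1] pos_sq_deriv
  show ?thesis
    unfolding ramp_def hat_def by (rule derivative_eq_intros * refl | simp)+
qed

lemma ramp_eq_0: "x \<le> 0 \<Longrightarrow> ramp x = 0"
  by (simp add: ramp_def pos_sq_def)

lemma ramp_eq_1: "1 \<le> x \<Longrightarrow> ramp x = 1"
  by (simp add: ramp_def pos_sq_def power2_eq_square algebra_simps)

lemma hat_eq_0: "x \<le> 0 \<or> 1 \<le> x \<Longrightarrow> hat x = 0"
  by (auto simp: hat_def max_def)

lemma hat_bounds: "0 \<le> hat x" "hat x \<le> 2"
  by (auto simp: hat_def max_def)

lemma continuous_hat [continuous_intros]:
  "continuous_on A f \<Longrightarrow> continuous_on A (\<lambda>x. hat (f x))"
  unfolding hat_def by (intro continuous_intros)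

lemma ramp_bounds: "0 \<le> ramp x" "ramp x \<le> 1"
proof -
  \<comment> \<open>\<open>hat\<close> is nonnegative, so the bounds can be read off at min x 0 and
    max x 1, where the values 0 and 1 are known.\<close>
  have mono: "ramp a \<le> ramp b" if "a \<le> b" for a b
    using DERIV_nonneg_imp_nondecreasing[OF that] ramp_deriv hat_bounds by blast
  show "0 \<le> ramp x" using mono[of "min x 0" x] ramp_eq_0[of "min x 0"] by simp
  show "ramp x \<le> 1" using mono[of x "max x 1"] ramp_eq_1[of "max x 1"] by simp
qed

lemma continuous_ramp [continuous_intros]:
  "continuous_on A f \<Longrightarrow> continuous_on A (\<lambda>x. ramp (f x))"
  using DERIV_continuous_on[OF has_field_derivative_at_within[OF ramp_deriv], of UNIV]
  by (rule continuous_on_compose2) auto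

text \<open>Smoothed indicator for 0 < e and c \<le> d. Both flanks lie to the right of their
  nominal points, [c,c+e] going up and [d,d+e] going down; so the support is in [c,d+e], and for e
  to 0 the limit is the indicator of a half-open interval.\<close>

definition window :: "real \<Rightarrow> real \<Rightarrow> real \<Rightarrow> real \<Rightarrow> real" where
  "window c d e s = ramp ((s - c) / e) - ramp ((s - d) / e)"

definition window' :: "real \<Rightarrow> real \<Rightarrow> real \<Rightarrow> real \<Rightarrow> real" where
  "window' c d e s = hat ((s - c) / e) / e - hat ((s - d) / e) / e"

lemma window_deriv: "(window c d e has_real_derivative window' c d e s) (at s)"
proof -
  have "((\<lambda>s. ramp ((s - a) / e)) has_real_derivative hat ((s - a) / e) / e) (at s)" for a
  proof -
    have "((\<lambda>s. (s - a) / e) has_real_derivative 1 / e) (at s)"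
      by (rule DERIV_cdivide) (auto intro!: derivative_eq_intros)
    from DERIV_chain2[OF ramp_deriv this] show ?thesis by simp
  qed
  then show ?thesis
    unfolding window_def[abs_def] window'_def by (intro DERIV_diff)
qed

lemma continuous_window: "continuous_on A (window c d e)"
  unfolding window_def by (cases "e = 0") (auto intro!: continuous_intros)

lemma continuous_window': "continuous_on A (window' c d e)"
  unfolding window'_def by (cases "e = 0") (auto intro!: continuous_intros)

lemma window_eq_0:
  assumes "0 < e" "c \<le> d" "s \<notin> {c..d + e}"
  shows "window c d e s = 0"
proof (cases "s < c")
  case True
  then show ?thesis using assms
    by (auto simp: window_def ramp_eq_0 divide_nonpos_pos)
next
  case False
  then show ?thesis using assms
    by (auto simp: window_def ramp_eq_1)
qed

lemma abs_window_le: "\<bar>window c d e s\<bar> \<le> 1"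
  using ramp_bounds[of "(s - c) / e"] ramp_bounds[of "(s - d) / e"]
  by (auto simp: window_def)

text \<open>At s = c every term is 0, since the flank starts there; for s > c the flank is passed
  once e / (n + 1) \<le> s - c. These widths never exceed e, so all windows of the sequence keep
  their supports inside one fixed interval.\<close>

lemma ramp_tendsto:
  assumes "0 < e"
  shows "(\<lambda>n. ramp ((s - c) / (e / real (Suc n)))) \<longlonglongrightarrow> indicat_real {c<..} s"
proof (cases "c < s")
  case True
  obtain N where N: "e / (s - c) < real N" using reals_Archimedean2 by blast
  have "\<forall>\<^sub>F n in sequentially. ramp ((s - c) / (e / real (Suc n))) = 1"
    using eventually_ge_at_top[of N]
  proof eventually_elim
    case (elim n)
    then have "e / (s - c) \<le> real (Suc n)" using N by linarith
    then show ?case using True assms by (intro ramp_eq_1) (simp add: field_simps)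
  qed
  then show ?thesis using True by (simp add: tendsto_eventually)
next
  case False
  then have "ramp ((s - c) / (e / real (Suc n))) = 0" for n
    using assms by (intro ramp_eq_0 divide_nonpos_pos) auto
  then show ?thesis using False by simp
qed

lemma integral_window_tendsto:
  assumes g: "integrable (lebesgue_on {a..b}) g" and "0 < e"  "c \<le> d"
  shows "(\<lambda>n. LINT s|lebesgue_on {a..b}. g s * window c d (e / real (Suc n)) s)
    \<longlonglongrightarrow> (LINT s|lebesgue_on {a..b}. g s * indicat_real {c<..d} s)"
proof (rule integral_dominated_convergence[where w = "\<lambda>s. norm (g s)"])
  have [measurable]: "window c d e' \<in> borel_measurable (lebesgue_on {a..b})" for e'
    by (intro continuous_imp_measurable_on_sets_lebesgue continuous_window) auto
  have [measurable]: "g \<in> borel_measurable (lebesgue_on {a..b})" using g by auto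
  show "(\<lambda>s. g s * window c d (e / real (Suc n)) s) \<in> borel_measurable (lebesgue_on {a..b})" for n
    by measurable
  have "indicat_real {c<..d} \<in> borel_measurable lebesgue"
    by (intro borel_measurable_indicator) auto
  then have [measurable]: "indicat_real {c<..d} \<in> borel_measurable (lebesgue_on {a..b})"
    by (rule measurable_restrict_space1)
  show "(\<lambda>s. g s * indicat_real {c<..d} s) \<in> borel_measurable (lebesgue_on {a..b})"
    by measurable
  show "integrable (lebesgue_on {a..b}) (\<lambda>s. norm (g s))" using g by auto
  show "AE s in lebesgue_on {a..b}.
      (\<lambda>n. g s * window c d (e / real (Suc n)) s) \<longlonglongrightarrow> g s * indicat_real {c<..d} s"
  proof (intro AE_I2 tendsto_mult tendsto_const)
    fix s
    have "indicat_real {c<..d} s = indicat_real {c<..} s - indicat_real {d<..} s"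
      using \<open>c \<le> d\<close> by (auto simp: indicator_def)
    then show "(\<lambda>n. window c d (e / real (Suc n)) s) \<longlonglongrightarrow> indicat_real {c<..d} s"
      unfolding window_def using ramp_tendsto[OF \<open>0 < e\<close>] by (simp only: tendsto_diff)
  qed
  show "AE s in lebesgue_on {a..b}. norm (g s * window c d (e / real (Suc n)) s) \<le> norm (g s)" for n
    by (auto simp: abs_mult intro!: AE_I2 mult_left_le abs_window_le)
qed

section \<open>One-sided mollifiers and the fundamental theorem for weak derivatives\<close>

lemma integral_hat: "(LINT s|lebesgue_on {0..1}. hat s) = 1"
proof -
  have "(hat has_integral ramp 1 - ramp 0) {0..1}"
    by (rule fundamental_theorem_of_calculus)
       (auto simp: has_real_derivative_iff_has_vector_derivative[symmetric]
          intro: has_field_derivative_at_within ramp_deriv)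
  moreover have "integrable (lebesgue_on {0..1}) hat"
    using continuous_hat[of "{0..1}" "\<lambda>x. x"]
    by (intro continuous_imp_integrable_real) auto
  ultimately show ?thesis
    by (simp add: lebesgue_integral_eq_integral integral_unique ramp_eq_0 ramp_eq_1)
qed

text \<open>The scaled triangles have mass 1 on [c, c + e/(n+1)], to the right of c, so c = a is
  admissible. After substitution the kernel is independent of n and continuity of f at c decides the
  limit; 2B dominates when |f| \<le> B.\<close>

lemma integral_hat_tendsto:
  fixes f :: "real \<Rightarrow> real"
  assumes f: "continuous_on {a..b} f" and "0 < e" "a \<le> c" "c + e \<le> b"
  shows "(\<lambda>n. LINT s|lebesgue_on {a..b}. f s * (hat ((s - c) / (e / real (Suc n))) / (e / real (Suc n))))
    \<longlonglongrightarrow> f c"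
proof -
  define E where "E = (\<lambda>n. e / real (Suc n))"
  have E: "0 < E n" "E n \<le> e" for n
    using \<open>0 < e\<close> by (auto simp: E_def field_simps)
  have E0: "E \<longlonglongrightarrow> 0"
    unfolding E_def by (rule LIMSEQ_Suc) (rule lim_const_over_n)
  have inI: "c + E n * s \<in> {a..b}" if "s \<in> {0..1}" for n s
  proof -
    have "E n * s \<le> e * 1"
      using that E[of n] \<open>0 < e\<close> by (intro mult_mono) auto
    moreover have "0 \<le> E n * s" using that E[of n] by simp
    ultimately show ?thesis using assms by auto
  qed
  have subst: "(LINT s|lebesgue_on {a..b}. f s * (hat ((s - c) / E n) / E n)) =
     (LINT s|lebesgue_on {0..1}. f (c + E n * s) * hat s)" for n
  proof -
    \<comment> \<open>Outside [c, c + E n] the kernel vanishes; the domain has to shrink to that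
      interval for the substitution to land on [0,1].\<close>
    have "c + E n \<le> b" using E(2)[of n] assms by linarith
    then have "indicat_real {a..b} s * (f s * (hat ((s - c) / E n) / E n)) =
      indicat_real {c..c + E n} s * (f s * (hat ((s - c) / E n) / E n))" for s
      using assms E(1)[of n]
      by (auto simp: indicator_def divide_nonpos_pos intro!: hat_eq_0)
    then have "(LINT s|lebesgue_on {a..b}. f s * (hat ((s - c) / E n) / E n)) =
       (LINT s|lebesgue_on {c + E n * 0..c + E n * 1}. f s * (hat ((s - c) / E n) / E n))"
      by (subst (1 2) integral_restrict_space) (simp_all only: real_scaleR_def, auto)
    also have "\<dots> = (LINT s|lebesgue_on {0..1}. f (c + E n * s) * hat s)"
      using E(1)[of n] by (subst integral_affine_Icc) auto
    finally show ?thesis .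
  qed
  obtain B where B: "\<And>s. s \<in> {a..b} \<Longrightarrow> norm (f s) \<le> B"
    using compact_imp_bounded[OF compact_continuous_image[OF f compact_Icc]]
    unfolding bounded_iff by blast
  have "(\<lambda>n. LINT s|lebesgue_on {0..1}. f (c + E n * s) * hat s) \<longlonglongrightarrow>
     (LINT s|lebesgue_on {0..1}. f c * hat s)"
  proof (rule integral_dominated_convergence[where w = "\<lambda>s. B * 2"])
    show "(\<lambda>s. f c * hat s) \<in> borel_measurable (lebesgue_on {0..1})"
      by (intro continuous_imp_measurable_on_sets_lebesgue continuous_intros) auto
    show "(\<lambda>s. f (c + E n * s) * hat s) \<in> borel_measurable (lebesgue_on {0..1})" for n
      by (intro continuous_imp_measurable_on_sets_lebesgue continuous_intros
           continuous_on_compose2[OF f]) (use inI in auto)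
    show "integrable (lebesgue_on {0..1::real}) (\<lambda>s. B * 2)"
      by (intro continuous_imp_integrable_real) auto
    show "AE s in lebesgue_on {0..1}. (\<lambda>n. f (c + E n * s) * hat s) \<longlonglongrightarrow> f c * hat s"
    proof (intro AE_I2 tendsto_mult tendsto_const)
      fix s assume "s \<in> space (lebesgue_on {0..1::real})"
      then have s: "s \<in> {0..1}" by simp
      have "(\<lambda>n. c + E n * s) \<longlonglongrightarrow> c" by (rule tendsto_eq_intros E0 | simp)+
      then show "(\<lambda>n. f (c + E n * s)) \<longlonglongrightarrow> f c"
        by (intro continuous_on_tendsto_compose[OF f]) (use inI[OF s] assms in auto)
    qed
    show "AE s in lebesgue_on {0..1}. norm (f (c + E n * s) * hat s) \<le> B * 2" for n
    proof (intro AE_I2)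
      fix s assume "s \<in> space (lebesgue_on {0..1::real})"
      then have s: "s \<in> {0..1}" by simp
      have "norm (f (c + E n * s)) \<le> B" by (rule B[OF inI[OF s]])
      moreover have "norm (hat s) \<le> 2" using hat_bounds[of s] by simp
      ultimately show "norm (f (c + E n * s) * hat s) \<le> B * 2"
        by (metis norm_ge_zero norm_mult mult_mono order_trans)
    qed
  qed
  then have "(\<lambda>n. LINT s|lebesgue_on {a..b}. f s * (hat ((s - c) / E n) / E n)) \<longlonglongrightarrow> f c"
    unfolding subst by (simp add: integral_hat)
  then show ?thesis unfolding E_def .
qed

text \<open>Bridge between two integrals: limits of test integrals are Lebesgue integrals, while
  primitives are handled with the gauge integral. The missing left end point is negligible.\<close>

lemma integral_mult_indicator_Ioc:
  fixes g :: "real \<Rightarrow> real"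
  assumes "integrable (lebesgue_on {a..b}) g" "a \<le> c" "d \<le> b"
  shows "(LINT s|lebesgue_on {a..b}. g s * indicat_real {c<..d} s) = integral {c..d} g"
proof -
  have sub: "{c<..d} \<subseteq> {a..b}" using assms by auto
  have int: "integrable (lebesgue_on {c<..d}) g"
    using assms(1) integrable_mult_indicator[of "{c<..d}" lebesgue "\<lambda>s. indicator {a..b} s *\<^sub>R g s"] sub
    by (simp add: integrable_restrict_space indicator_inter_arith[symmetric] Int_absorb2
        flip: scaleR_scaleR mult.assoc)
  have "indicat_real {a..b} s * (g s * indicat_real {c<..d} s) = indicat_real {c<..d} s * g s" for s
    using sub by (auto simp: indicator_def)
  then have "(LINT s|lebesgue_on {a..b}. g s * indicat_real {c<..d} s) = (LINT s|lebesgue_on {c<..d}. g s)"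
    by (subst (1 2) integral_restrict_space) (simp_all only: real_scaleR_def, auto)
  also have "\<dots> = integral {c<..d} g"
    by (intro lebesgue_integral_eq_integral int) auto
  also have "\<dots> = integral {c..d} g"
    by (rule integral_subset_negligible) (auto intro: negligible_subset[of "{c}"])
  finally show ?thesis .
qed

text \<open>Testing with \<open>window c d e\<close> compares a mean of f just right of c with a
  mean just right of d, and the limit is the increment formula. The support of a window must lie
  inside (a,b), so the test covers a < c and d < b; continuity settles the end points.\<close>

lemma weak_deriv_FTC:
  fixes f g :: "real \<Rightarrow> real"
  assumes ab: "a < b" and f: "continuous_on {a..b} f" and g: "integrable (lebesgue_on {a..b}) g"
    and weak: "has_weak_deriv {a..b} f g" and cd: "a \<le> c" "c \<le> d" "d \<le> b"
  shows "(g has_integral (f d - f c)) {c..d}"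
proof -
  have g': "g integrable_on {a..b}" by (rule integrable_on_lebesgue_on[OF g]) auto
  have inner: "f d - f c = integral {c..d} g" if cd: "a < c" "c \<le> d" "d < b" for c d
  proof -
    \<comment> \<open>Half of the gap to b leaves room for the falling flank [d,d+e].\<close>
    define e where "e = (b - d) / 2"
    have e: "0 < e" "d + e < b" using cd by (auto simp: e_def field_simps)
    have eq: "(LINT s|lebesgue_on {a..b}. f s * window' c d (e / real (Suc n)) s) =
       - (LINT s|lebesgue_on {a..b}. g s * window c d (e / real (Suc n)) s)" for n
    proof -
      have n: "0 < e / real (Suc n)" "e / real (Suc n) \<le> e" using e by (auto simp: field_simps)
      have "{c..d + e / real (Suc n)} \<subseteq> interior {a..b}"
        using cd e n by (auto simp del: of_nat_Suc)
      then show ?thesis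
        by (intro has_weak_derivD[OF weak window_deriv continuous_window' compact_Icc _
              window_eq_0[OF n(1) cd(2)]])
    qed
    have int: "integrable (lebesgue_on {a..b}) (\<lambda>s. f s * (hat ((s - p) / (e / real (Suc n))) / (e / real (Suc n))))" for n p
      by (intro continuous_imp_integrable_real continuous_intros f) (use e in auto)
    have "(\<lambda>n. LINT s|lebesgue_on {a..b}. f s * window' c d (e / real (Suc n)) s) \<longlonglongrightarrow> f c - f d"
    proof -
      have "(\<lambda>n. (LINT s|lebesgue_on {a..b}. f s * (hat ((s - c) / (e / real (Suc n))) / (e / real (Suc n))))
        - (LINT s|lebesgue_on {a..b}. f s * (hat ((s - d) / (e / real (Suc n))) / (e / real (Suc n)))))
        \<longlonglongrightarrow> f c - f d"
        by (intro tendsto_diff integral_hat_tendsto[OF f]) (use cd e in auto)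
      then show ?thesis
        by (simp only: window'_def right_diff_distrib Bochner_Integration.integral_diff[OF int int])
    qed
    moreover have "(\<lambda>n. - (LINT s|lebesgue_on {a..b}. g s * window c d (e / real (Suc n)) s)) \<longlonglongrightarrow>
        - (LINT s|lebesgue_on {a..b}. g s * indicat_real {c<..d} s)"
      by (intro tendsto_minus integral_window_tendsto g e cd)
    ultimately have "f c - f d = - (LINT s|lebesgue_on {a..b}. g s * indicat_real {c<..d} s)"
      unfolding eq by (rule LIMSEQ_unique)
    then show ?thesis
      using integral_mult_indicator_Ioc[OF g, of c d] cd by simp
  qed
  \<comment> \<open>The defect between f and the primitive of g: constant on the open interval by
    \<open>inner\<close>, compared at the midpoint, and continuous up to the boundary.\<close>
  define h where "h = (\<lambda>x. f x - integral {a..x} g)"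
  have h: "continuous_on {a..b} h"
    unfolding h_def by (intro continuous_intros f indefinite_integral_continuous_1 g')
  have comb: "integral {a..x} g + integral {x..y} g = integral {a..y} g" if "a \<le> x" "x \<le> y" "y \<le> b" for x y
    using that by (intro Henstock_Kurzweil_Integration.integral_combine integrable_on_subinterval[OF g']) auto
  define m where "m = (a + b) / 2"
  have m: "a < m" "m < b" using ab by (auto simp: m_def field_simps)
  have "h x = h m" if "x \<in> {a<..<b}" for x
  proof (cases "x \<le> m")
    case True
    then show ?thesis using inner[of x m] comb[of x m] that m by (simp add: h_def)
  next
    case False
    then show ?thesis using inner[of m x] comb[of m x] that m by (simp add: h_def)
  qed
  moreover have "closure {a<..<b} = {a..b}" using ab by simp
  ultimately have "h x = h m" if "x \<in> {a..b}" for x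
    using continuous_constant_on_closure[of "{a<..<b}" h "h m" x] h that by simp
  then have "h c = h d" using cd by simp
  then have "integral {c..d} g = f d - f c"
    using comb[of c d] cd by (simp add: h_def)
  moreover have "g integrable_on {c..d}" using cd by (intro integrable_on_subinterval[OF g']) auto
  ultimately show ?thesis by (simp add: has_integral_integrable_integral)
qed

section \<open>Continuity of translations in $L_2$\<close>

lemma square_sum_le: "((a::real) + b)\<^sup>2 \<le> 2 * a\<^sup>2 + 2 * b\<^sup>2"
  using sum_squares_bound[of a b] by (simp add: power2_sum)

text \<open>Substitute for the triangle inequality: at the price of a factor 2 it involves squared
  distances alone, and extended nonnegative integrals cover infinite distances too.\<close>

lemma nn_integral_square_diff_le:
  fixes f g h :: "'a \<Rightarrow> real"
  assumes [measurable]: "f \<in> borel_measurable M" "g \<in> borel_measurable M" "h \<in> borel_measurable M"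
  shows "(\<integral>\<^sup>+x. ennreal ((f x - h x)\<^sup>2) \<partial>M) \<le>
    2 * (\<integral>\<^sup>+x. ennreal ((f x - g x)\<^sup>2) \<partial>M) + 2 * (\<integral>\<^sup>+x. ennreal ((g x - h x)\<^sup>2) \<partial>M)"
proof -
  have "(\<integral>\<^sup>+x. ennreal ((f x - h x)\<^sup>2) \<partial>M) \<le>
      (\<integral>\<^sup>+x. 2 * ennreal ((f x - g x)\<^sup>2) + 2 * ennreal ((g x - h x)\<^sup>2) \<partial>M)"
  proof (rule nn_integral_mono)
    fix x
    have "ennreal ((f x - h x)\<^sup>2) \<le> ennreal (2 * (f x - g x)\<^sup>2 + 2 * (g x - h x)\<^sup>2)"
      using square_sum_le[of "f x - g x" "g x - h x"] by (intro ennreal_leI) simp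
    then show "ennreal ((f x - h x)\<^sup>2) \<le> 2 * ennreal ((f x - g x)\<^sup>2) + 2 * ennreal ((g x - h x)\<^sup>2)"
      by (simp add: ennreal_plus ennreal_mult)
  qed
  also have "\<dots> = 2 * (\<integral>\<^sup>+x. ennreal ((f x - g x)\<^sup>2) \<partial>M) + 2 * (\<integral>\<^sup>+x. ennreal ((g x - h x)\<^sup>2) \<partial>M)"
    by (subst nn_integral_add) (auto simp: nn_integral_cmult)
  finally show ?thesis .
qed

text \<open>Truncation in height and in range. For M \<ge> 0 the first factor is a trapezoid, 1 for
  |x| \<le> M and 0 for |x| \<ge> M + 1, so that continuous functions stay continuous; a sharp cut
  would in general destroy this.\<close>

definition clamp_cut :: "real \<Rightarrow> (real \<Rightarrow> real) \<Rightarrow> real \<Rightarrow> real" where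
  "clamp_cut M f x = max 0 (min 1 (M + 1 - \<bar>x\<bar>)) * max (- M) (min M (f x))"

lemma clamp_cut_eq_0: "M + 1 < \<bar>x\<bar> \<Longrightarrow> clamp_cut M f x = 0"
  by (simp add: clamp_cut_def)

lemma clamp_cut_eq: "\<bar>x\<bar> \<le> M \<Longrightarrow> \<bar>f x\<bar> \<le> M \<Longrightarrow> clamp_cut M f x = f x"
  by (auto simp: clamp_cut_def)

lemma abs_clamp_cut_le:
  assumes "0 \<le> M" shows "\<bar>clamp_cut M f x\<bar> \<le> M"
proof -
  have "\<bar>clamp_cut M f x\<bar> \<le> 1 * M"
    unfolding clamp_cut_def abs_mult using assms by (intro mult_mono) auto
  then show ?thesis by simp
qed

text \<open>Clamping and damping move f x towards 0 without crossing it, so the error is at most |f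
  x|. This supplies the integrable majorant as M grows.\<close>

lemma clamp_cut_diff_square_le:
  assumes "0 \<le> M" shows "(clamp_cut M f x - f x)\<^sup>2 \<le> (f x)\<^sup>2"
proof -
  define c where "c = max 0 (min 1 (M + 1 - \<bar>x\<bar>))"
  define y where "y = max (- M) (min M (f x))"
  have c: "0 \<le> c" "c \<le> 1" by (auto simp: c_def)
  have "\<bar>c * y - f x\<bar> \<le> \<bar>f x\<bar>"
  proof (cases "0 \<le> f x")
    case True
    then have "0 \<le> y" "y \<le> f x" using assms by (auto simp: y_def)
    moreover from this have "0 \<le> c * y" "c * y \<le> y" using c
      by (auto intro: mult_left_le_one_le)
    ultimately show ?thesis by auto
  next
    case False
    then have "y \<le> 0" "f x \<le> y" using assms by (auto simp: y_def)
    moreover from this have "c * y \<le> 0" "y \<le> c * y" using c mult_right_mono_neg[of c 1 y]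
      by (auto intro: mult_nonneg_nonpos)
    ultimately show ?thesis by auto
  qed
  then show ?thesis
    by (simp add: clamp_cut_def c_def y_def abs_le_square_iff)
qed

lemma borel_measurable_clamp_cut [measurable]:
  assumes [measurable]: "f \<in> borel_measurable borel"
  shows "clamp_cut M f \<in> borel_measurable borel"
  unfolding clamp_cut_def[abs_def]
  by (intro borel_measurable_times borel_measurable_max borel_measurable_min borel_measurable_diff
      borel_measurable_abs assms) auto

lemma continuous_clamp_cut: "continuous_on UNIV f \<Longrightarrow> continuous_on UNIV (clamp_cut M f)"
  unfolding clamp_cut_def[abs_def] by (intro continuous_intros)

lemma square_integrable_approx_clamp_cut:
  assumes g[measurable]: "g \<in> borel_measurable borel"
    and fin: "(\<integral>\<^sup>+x. ennreal ((g x)\<^sup>2) \<partial>lborel) < \<infinity>"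
  shows "(\<lambda>m. \<integral>\<^sup>+x. ennreal ((g x - clamp_cut (real m) g x)\<^sup>2) \<partial>lborel) \<longlonglongrightarrow> 0"
proof -
  have "(\<lambda>m. \<integral>\<^sup>+x. ennreal ((g x - clamp_cut (real m) g x)\<^sup>2) \<partial>lborel) \<longlonglongrightarrow> (\<integral>\<^sup>+x. 0 \<partial>(lborel :: real measure))"
  proof (rule nn_integral_dominated_convergence[where w = "\<lambda>x. ennreal ((g x)\<^sup>2)"])
    show "AE x in lborel. ennreal ((g x - clamp_cut (real m) g x)\<^sup>2) \<le> ennreal ((g x)\<^sup>2)" for m
      using clamp_cut_diff_square_le[of "real m" g]
      by (intro AE_I2 ennreal_leI) (simp add: power2_commute)
    show "AE x in lborel. (\<lambda>m. ennreal ((g x - clamp_cut (real m) g x)\<^sup>2)) \<longlonglongrightarrow> 0"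
    proof (intro AE_I2)
      fix x
      obtain N where N: "max \<bar>x\<bar> \<bar>g x\<bar> < real N" using reals_Archimedean2 by blast
      have "\<forall>\<^sub>F m in sequentially. ennreal ((g x - clamp_cut (real m) g x)\<^sup>2) = 0"
        using eventually_ge_at_top[of N]
      proof eventually_elim
        case (elim m)
        then have "clamp_cut (real m) g x = g x" using N by (intro clamp_cut_eq) auto
        then show ?case by simp
      qed
      then show "(\<lambda>m. ennreal ((g x - clamp_cut (real m) g x)\<^sup>2)) \<longlonglongrightarrow> 0"
        by (rule tendsto_eventually)
    qed
  qed (use fin in auto)
  then show ?thesis by simp
qed

text \<open>Almost everywhere convergence alone gives no norm convergence. Truncating both functions
  bounds their difference by 2M on [-(M+1), M+1] and makes it 0 elsewhere, so dominated convergence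
  applies.\<close>

lemma clamp_cut_approx_continuous:
  assumes g[measurable]: "g \<in> borel_measurable borel" and "0 \<le> M"
    and Gc: "\<And>n. continuous_on UNIV (G n)" and G: "AE x in lborel. (\<lambda>n. G n x) \<longlonglongrightarrow> g x"
  shows "(\<lambda>n. \<integral>\<^sup>+x. ennreal ((clamp_cut M g x - clamp_cut M (G n) x)\<^sup>2) \<partial>lborel) \<longlonglongrightarrow> 0"
proof -
  have [measurable]: "G n \<in> borel_measurable borel" for n
    by (intro borel_measurable_continuous_onI Gc)
  have "(\<lambda>n. \<integral>\<^sup>+x. ennreal ((clamp_cut M g x - clamp_cut M (G n) x)\<^sup>2) \<partial>lborel) \<longlonglongrightarrow>
      (\<integral>\<^sup>+x. 0 \<partial>(lborel :: real measure))"
  proof (rule nn_integral_dominated_convergence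
      [where w = "\<lambda>x. ennreal ((2 * M)\<^sup>2) * indicator {- (M + 1)..M + 1} x"])
    show "AE x in lborel. ennreal ((clamp_cut M g x - clamp_cut M (G n) x)\<^sup>2) \<le>
        ennreal ((2 * M)\<^sup>2) * indicator {- (M + 1)..M + 1} x" for n
    proof (intro AE_I2)
      fix x
      show "ennreal ((clamp_cut M g x - clamp_cut M (G n) x)\<^sup>2) \<le>
          ennreal ((2 * M)\<^sup>2) * indicator {- (M + 1)..M + 1} x"
      proof (cases "\<bar>x\<bar> \<le> M + 1")
        case True
        have "\<bar>clamp_cut M g x - clamp_cut M (G n) x\<bar> \<le> 2 * M"
          using abs_clamp_cut_le[OF \<open>0 \<le> M\<close>, of g x] abs_clamp_cut_le[OF \<open>0 \<le> M\<close>, of "G n" x]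
          by linarith
        then have "(clamp_cut M g x - clamp_cut M (G n) x)\<^sup>2 \<le> (2 * M)\<^sup>2"
          using \<open>0 \<le> M\<close> abs_le_square_iff[of _ "2 * M"] by simp
        moreover have "x \<in> {- (M + 1)..M + 1}" using True by auto
        ultimately show ?thesis by (simp add: ennreal_leI del: atLeastAtMost_iff)
      next
        case False
        then show ?thesis by (simp add: clamp_cut_eq_0)
      qed
    qed
    show "(\<integral>\<^sup>+x. ennreal ((2 * M)\<^sup>2) * indicator {- (M + 1)..M + 1} x \<partial>lborel) < \<infinity>"
      by (simp add: nn_integral_cmult ennreal_mult_less_top emeasure_lborel_Icc_eq)
    show "AE x in lborel. (\<lambda>n. ennreal ((clamp_cut M g x - clamp_cut M (G n) x)\<^sup>2)) \<longlonglongrightarrow> 0"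
      using G
    proof eventually_elim
      case (elim x)
      then have "(\<lambda>n. (clamp_cut M g x - clamp_cut M (G n) x)\<^sup>2) \<longlonglongrightarrow> (clamp_cut M g x - clamp_cut M g x)\<^sup>2"
        unfolding clamp_cut_def by (intro tendsto_intros)
      then show ?case using tendsto_ennrealI by fastforce
    qed
  qed auto
  then show ?thesis by simp
qed

text \<open>Density of continuous functions with bounded support in L2. Lebesgue measurability
  provides continuous functions converging off a null set; truncation turns this into convergence in
  norm.\<close>

lemma square_integrable_continuous_approx:
  assumes g[measurable]: "g \<in> borel_measurable borel"
    and fin: "(\<integral>\<^sup>+x. ennreal ((g x)\<^sup>2) \<partial>lborel) < \<infinity>" and "0 < \<epsilon>"
  obtains k :: "real \<Rightarrow> real" and M where "continuous_on UNIV k" "\<And>x. M < \<bar>x\<bar> \<Longrightarrow> k x = 0" "0 \<le> M"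
    "(\<integral>\<^sup>+x. ennreal ((g x - k x)\<^sup>2) \<partial>lborel) < ennreal \<epsilon>"
proof -
  have "g \<in> borel_measurable lebesgue" by (intro measurable_completion) simp
  then have "g measurable_on UNIV" by (rule lebesgue_measurable_imp_measurable_on) auto
  then obtain N G where "negligible N" and Gc: "\<And>n. continuous_on UNIV (G n)"
    and lim: "\<And>x. x \<notin> N \<Longrightarrow> (\<lambda>n. G n x) \<longlonglongrightarrow> g x"
    unfolding measurable_on_def by auto
  have "AE x in lebesgue. x \<notin> N"
    using \<open>negligible N\<close> by (intro AE_not_in) (simp add: negligible_iff_null_sets)
  then have G: "AE x in lborel. (\<lambda>n. G n x) \<longlonglongrightarrow> g x"
    using lim by (auto simp: AE_completion_iff elim: eventually_mono)
  have [measurable]: "G n \<in> borel_measurable borel" for n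
    by (intro borel_measurable_continuous_onI Gc)
  \<comment> \<open>Two errors below \<epsilon>/4, each doubled by the quasi-triangle
    inequality.\<close>
  have e4: "(0::ennreal) < ennreal (\<epsilon> / 4)" using \<open>0 < \<epsilon>\<close> by simp
  obtain m where m: "(\<integral>\<^sup>+x. ennreal ((g x - clamp_cut (real m) g x)\<^sup>2) \<partial>lborel) < ennreal (\<epsilon> / 4)"
    using order_tendstoD(2)[OF square_integrable_approx_clamp_cut[OF g fin] e4]
    by (auto simp: eventually_sequentially)
  obtain n where n: "(\<integral>\<^sup>+x. ennreal ((clamp_cut (real m) g x - clamp_cut (real m) (G n) x)\<^sup>2) \<partial>lborel)
      < ennreal (\<epsilon> / 4)"
    using order_tendstoD(2)[OF clamp_cut_approx_continuous[OF g _ Gc G, of "real m"] e4]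
    by (auto simp: eventually_sequentially)
  show ?thesis
  proof (rule that[of "clamp_cut (real m) (G n)" "real m + 1"])
    have "(\<integral>\<^sup>+x. ennreal ((g x - clamp_cut (real m) (G n) x)\<^sup>2) \<partial>lborel) \<le>
      2 * (\<integral>\<^sup>+x. ennreal ((g x - clamp_cut (real m) g x)\<^sup>2) \<partial>lborel) +
      2 * (\<integral>\<^sup>+x. ennreal ((clamp_cut (real m) g x - clamp_cut (real m) (G n) x)\<^sup>2) \<partial>lborel)"
      by (rule nn_integral_square_diff_le) auto
    also have "\<dots> < 2 * ennreal (\<epsilon> / 4) + 2 * ennreal (\<epsilon> / 4)"
      using m n by (intro add_strict_mono ennreal_mult_strict_left_mono) auto
    also have "\<dots> = ennreal \<epsilon>"
      using \<open>0 < \<epsilon>\<close> by (simp add: ennreal_mult[symmetric] ennreal_plus[symmetric]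
          flip: ennreal_numeral del: ennreal_plus)
    finally show "(\<integral>\<^sup>+x. ennreal ((g x - clamp_cut (real m) (G n) x)\<^sup>2) \<partial>lborel) < ennreal \<epsilon>" .
  qed (auto intro: continuous_clamp_cut Gc clamp_cut_eq_0)
qed

text \<open>Uniform continuity gives the claim for a continuous k with bounded support, and
  translations preserve the L2 distance between g and k.\<close>

lemma square_integrable_translation:
  fixes g :: "real \<Rightarrow> real"
  assumes g[measurable]: "g \<in> borel_measurable borel"
    and fin: "(\<integral>\<^sup>+x. ennreal ((g x)\<^sup>2) \<partial>lborel) < \<infinity>" and e: "0 < \<epsilon>"
  obtains d where "0 < d" "\<And>\<delta>. \<bar>\<delta>\<bar> < d \<Longrightarrow> (\<integral>\<^sup>+x. ennreal ((g (x + \<delta>) - g x)\<^sup>2) \<partial>lborel) \<le> ennreal \<epsilon>"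
proof -
  \<comment> \<open>Two uses of the quasi-triangle inequality weigh the three errors by 2, 4 and 4,
    so \<epsilon>/12 for each gives 10/12 of \<epsilon> in total.\<close>
  have e12: "0 < \<epsilon> / 12" using e by simp
  obtain k M where k: "continuous_on UNIV k" and k0: "\<And>x. M < \<bar>x\<bar> \<Longrightarrow> k x = 0" and M: "0 \<le> M"
    and approx: "(\<integral>\<^sup>+x. ennreal ((g x - k x)\<^sup>2) \<partial>lborel) < ennreal (\<epsilon> / 12)"
    by (rule square_integrable_continuous_approx[OF g fin e12]) (rule that)
  have [measurable]: "k \<in> borel_measurable borel" by (intro borel_measurable_continuous_onI k)
  \<comment> \<open>Chosen so that \<eta>^2 times the length 2M + 2 of [-(M+1), M+1] is
    \<epsilon>/12.\<close>
  define \<eta> where "\<eta> = sqrt (\<epsilon> / (12 * (2 * M + 2)))"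
  have \<eta>: "0 < \<eta>" "\<eta>\<^sup>2 * (2 * M + 2) = \<epsilon> / 12"
    using e M by (auto simp: \<eta>_def field_simps)
  \<comment> \<open>Shifts will be below 1: for |x| \<le> M + 1 both x and x + \<delta> lie in
    [-(M+2), M+2], and for |x| > M + 1 both are beyond M, where k vanishes.\<close>
  have "uniformly_continuous_on {- (M + 2)..M + 2} k"
    by (intro compact_uniformly_continuous continuous_on_subset[OF k]) auto
  then obtain d where d: "0 < d" and uc: "\<And>x y. x \<in> {- (M + 2)..M + 2} \<Longrightarrow> y \<in> {- (M + 2)..M + 2} \<Longrightarrow>
      \<bar>y - x\<bar> < d \<Longrightarrow> \<bar>k y - k x\<bar> < \<eta>"
    using \<eta>(1) unfolding uniformly_continuous_on_def dist_real_def by metis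
  show ?thesis
  proof (rule that[of "min d 1"])
    show "0 < min d 1" using d by simp
    fix \<delta> :: real assume \<delta>: "\<bar>\<delta>\<bar> < min d 1"
    have k_le: "ennreal ((k (x + \<delta>) - k x)\<^sup>2) \<le> ennreal (\<eta>\<^sup>2) * indicator {- (M + 1)..M + 1} x" for x
    proof (cases "\<bar>x\<bar> \<le> M + 1")
      case True
      then have "\<bar>k (x + \<delta>) - k x\<bar> < \<eta>" using \<delta> by (intro uc) auto
      then have "(k (x + \<delta>) - k x)\<^sup>2 \<le> \<eta>\<^sup>2"
        using \<eta>(1) abs_le_square_iff[of "k (x + \<delta>) - k x" \<eta>] by simp
      moreover have "x \<in> {- (M + 1)..M + 1}" using True by auto
      ultimately show ?thesis by (simp add: ennreal_leI del: atLeastAtMost_iff)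
    next
      case False
      then show ?thesis using \<delta> k0[of x] k0[of "x + \<delta>"] by auto
    qed
    have "(\<integral>\<^sup>+x. ennreal ((k (x + \<delta>) - k x)\<^sup>2) \<partial>lborel) \<le>
        (\<integral>\<^sup>+x. ennreal (\<eta>\<^sup>2) * indicator {- (M + 1)..M + 1} x \<partial>lborel)"
      by (intro nn_integral_mono k_le)
    also have "\<dots> = ennreal (\<eta>\<^sup>2 * (2 * M + 2))"
      using M by (simp add: nn_integral_cmult ennreal_mult algebra_simps)
    finally have k_est: "(\<integral>\<^sup>+x. ennreal ((k (x + \<delta>) - k x)\<^sup>2) \<partial>lborel) \<le> ennreal (\<epsilon> / 12)"
      by (simp add: \<eta>)
    have shift: "(\<integral>\<^sup>+x. ennreal ((g (x + \<delta>) - k (x + \<delta>))\<^sup>2) \<partial>lborel) \<le> ennreal (\<epsilon> / 12)"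
      using nn_integral_real_affine[of "\<lambda>x. ennreal ((g x - k x)\<^sup>2)" 1 \<delta>] approx
      by (simp add: add.commute)
    have gk: "(\<integral>\<^sup>+x. ennreal ((k x - g x)\<^sup>2) \<partial>lborel) \<le> ennreal (\<epsilon> / 12)"
      using approx by (simp add: power2_commute)
    have "(\<integral>\<^sup>+x. ennreal ((g (x + \<delta>) - g x)\<^sup>2) \<partial>lborel) \<le>
      2 * (\<integral>\<^sup>+x. ennreal ((g (x + \<delta>) - k (x + \<delta>))\<^sup>2) \<partial>lborel) +
      2 * (\<integral>\<^sup>+x. ennreal ((k (x + \<delta>) - g x)\<^sup>2) \<partial>lborel)"
      by (rule nn_integral_square_diff_le) auto
    also have "\<dots> \<le> 2 * (\<integral>\<^sup>+x. ennreal ((g (x + \<delta>) - k (x + \<delta>))\<^sup>2) \<partial>lborel) +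
      2 * (2 * (\<integral>\<^sup>+x. ennreal ((k (x + \<delta>) - k x)\<^sup>2) \<partial>lborel) +
           2 * (\<integral>\<^sup>+x. ennreal ((k x - g x)\<^sup>2) \<partial>lborel))"
      by (intro add_left_mono mult_left_mono nn_integral_square_diff_le) auto
    also have "\<dots> \<le> 2 * ennreal (\<epsilon> / 12) + 2 * (2 * ennreal (\<epsilon> / 12) + 2 * ennreal (\<epsilon> / 12))"
      by (intro add_mono mult_left_mono shift k_est gk) auto
    also have "\<dots> = ennreal (2 * (\<epsilon> / 12) + 2 * (2 * (\<epsilon> / 12) + 2 * (\<epsilon> / 12)))"
    proof -
      have two: "2 * ennreal y = ennreal (2 * y)" if "0 \<le> y" for y
        using that by (simp add: ennreal_mult)
      show ?thesis
        using e by (simp only: two ennreal_plus[symmetric] divide_nonneg_nonneg mult_nonneg_nonneg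
            add_nonneg_nonneg less_imp_le zero_le_numeral)
    qed
    also have "\<dots> \<le> ennreal \<epsilon>"
      using e by (intro ennreal_leI) simp
    finally show "(\<integral>\<^sup>+x. ennreal ((g (x + \<delta>) - g x)\<^sup>2) \<partial>lborel) \<le> ennreal \<epsilon>" .
  qed
qed

text \<open>Cauchy-Schwarz against the constant 1 on an interval of length 1. I is a gauge integral;
  if the right side is finite, v is Lebesgue integrable and the two integrals agree, and an infinite
  right side leaves nothing to show.\<close>

lemma square_integral_unit_interval_le:
  fixes v :: "real \<Rightarrow> real"
  assumes v[measurable]: "v \<in> borel_measurable borel" and I: "(v has_integral I) {0..1}"
  shows "ennreal (I\<^sup>2) \<le> (\<integral>\<^sup>+\<theta>. ennreal ((v \<theta>)\<^sup>2) * indicator {0..1} \<theta> \<partial>lborel)"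
proof (cases "(\<integral>\<^sup>+\<theta>. ennreal ((v \<theta>)\<^sup>2) * indicator {0..1} \<theta> \<partial>lborel) < \<infinity>")
  case True
  have vm: "v \<in> borel_measurable lebesgue" by (intro measurable_completion) simp
  then have vm'[measurable]: "v \<in> borel_measurable (lebesgue_on {0..1})"
    by (rule measurable_restrict_space1)
  have eq: "(\<integral>\<^sup>+\<theta>. ennreal ((v \<theta>)\<^sup>2) \<partial>lebesgue_on {0..1}) =
      (\<integral>\<^sup>+\<theta>. ennreal ((v \<theta>)\<^sup>2) * indicator {0..1} \<theta> \<partial>lborel)"
    by (subst nn_integral_restrict_space) (auto simp: nn_integral_completion)
  interpret finite_measure "lebesgue_on {0..1::real}"
    by (rule finite_measure_lebesgue_on) auto
  have "integrable (lebesgue_on {0..1}) (\<lambda>\<theta>. (v \<theta>)\<^sup>2)"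
    using True eq by (intro integrableI_bounded) auto
  then have int: "integrable (lebesgue_on {0..1}) v"
    by (rule square_integrable_imp_integrable[OF vm'])
  then have "I = (LINT \<theta>|lebesgue_on {0..1}. v \<theta>)"
    using I by (simp add: lebesgue_integral_eq_integral integral_unique)
  then have "ennreal \<bar>I\<bar> \<le> (\<integral>\<^sup>+\<theta>. ennreal \<bar>v \<theta>\<bar> \<partial>lebesgue_on {0..1})"
    using integral_norm_bound_ennreal[OF int] by simp
  then have "(ennreal \<bar>I\<bar>)\<^sup>2 \<le> (\<integral>\<^sup>+\<theta>. ennreal \<bar>v \<theta>\<bar> * 1 \<partial>lebesgue_on {0..1})\<^sup>2"
    by (simp add: power_mono)
  also have "\<dots> \<le> (\<integral>\<^sup>+\<theta>. (ennreal \<bar>v \<theta>\<bar>)\<^sup>2 \<partial>lebesgue_on {0..1}) * (\<integral>\<^sup>+\<theta>. 1\<^sup>2 \<partial>lebesgue_on {0..1::real})"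
    by (rule Cauchy_Schwarz_nn_integral) auto
  also have "\<dots> = (\<integral>\<^sup>+\<theta>. ennreal ((v \<theta>)\<^sup>2) \<partial>lebesgue_on {0..1})"
    by (simp add: ennreal_power emeasure_restrict_space)
  finally show ?thesis by (simp add: eq ennreal_power)
qed (simp add: not_less top_unique)

text \<open>The difference quotient is the mean of g over the segment from x to x + h. For negative
  h the segment is reversed and the sign is absorbed in 1 / - h.\<close>

lemma has_integral_reparam_unit_interval:
  fixes g F :: "real \<Rightarrow> real"
  assumes FTC: "\<And>c d. \<alpha> \<le> c \<Longrightarrow> c \<le> d \<Longrightarrow> d \<le> \<beta> \<Longrightarrow> (g has_integral (F d - F c)) {c..d}"
    and "x \<in> {\<alpha>..\<beta>}" "x + h \<in> {\<alpha>..\<beta>}" "h \<noteq> 0"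
  shows "((\<lambda>\<theta>. g (x + h * \<theta>)) has_integral (F (x + h) - F x) / h) {0..1}"
proof (cases "0 < h")
  case True
  have "(g has_integral (F (x + h) - F x)) (cbox x (x + h))"
    using FTC[of x "x + h"] True assms by simp
  from has_integral_affinity[OF this, of h x]
  have "((\<lambda>\<theta>. g (h * \<theta> + x)) has_integral (1 / h) * (F (x + h) - F x))
      ((\<lambda>y. (1 / h) * y + - ((1 / h) * x)) ` {x..x + h})"
    using True by (simp del: add_uminus_conv_diff)
  moreover have "(\<lambda>y. (1 / h) * y + - ((1 / h) * x)) ` {x..x + h} = {0..1}"
    unfolding image_affinity_atLeastAtMost using True by (simp add: field_simps)
  ultimately show ?thesis by (simp add: add.commute)
next
  case False
  then have h: "h < 0" using assms by simp
  have "(g has_integral (F x - F (x + h))) (cbox (x + h) x)"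
    using FTC[of "x + h" x] h assms by simp
  from has_integral_affinity[OF this, of h x]
  have "((\<lambda>\<theta>. g (h * \<theta> + x)) has_integral (1 / - h) * (F x - F (x + h)))
      ((\<lambda>y. (1 / h) * y + - ((1 / h) * x)) ` {x + h..x})"
    using h by (simp del: add_uminus_conv_diff)
  moreover have "(\<lambda>y. (1 / h) * y + - ((1 / h) * x)) ` {x + h..x} = {0..1}"
    unfolding image_affinity_atLeastAtMost using h by (simp add: field_simps)
  moreover have "(1 / - h) * (F x - F (x + h)) = (F (x + h) - F x) / h"
    using h by (simp add: field_simps)
  ultimately show ?thesis by (simp add: add.commute)
qed

text \<open>The error of the difference quotient at x is the mean over \<theta> in [0,1] of g(x +
  h\<theta>) - g(x). Its square is at most the mean of the squares, and after interchanging the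
  integrals each \<theta> contributes a squared translation distance.\<close>

lemma difference_quotient_L2:
  fixes g F :: "real \<Rightarrow> real"
  assumes g[measurable]: "g \<in> borel_measurable borel"
    and fin: "(\<integral>\<^sup>+x. ennreal ((g x)\<^sup>2) \<partial>lborel) < \<infinity>"
    and FTC: "\<And>c d. \<alpha> \<le> c \<Longrightarrow> c \<le> d \<Longrightarrow> d \<le> \<beta> \<Longrightarrow> (g has_integral (F d - F c)) {c..d}"
    and ab: "{a..b} \<subseteq> {\<alpha>..\<beta>}" and e: "0 < \<epsilon>"
  obtains d where "0 < d" "\<And>h. h \<noteq> 0 \<Longrightarrow> \<bar>h\<bar> < d \<Longrightarrow> {a + h..b + h} \<subseteq> {\<alpha>..\<beta>} \<Longrightarrow>
    (\<integral>\<^sup>+x. ennreal ((F (x + h) - F x - h * g x)\<^sup>2) * indicator {a..b} x \<partial>lborel) \<le> ennreal (\<epsilon> * h\<^sup>2)"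
proof -
  obtain d where d: "0 < d"
    and trans: "\<And>\<delta>. \<bar>\<delta>\<bar> < d \<Longrightarrow> (\<integral>\<^sup>+x. ennreal ((g (x + \<delta>) - g x)\<^sup>2) \<partial>lborel) \<le> ennreal \<epsilon>"
    using square_integrable_translation[OF g fin e] by blast
  show ?thesis
  proof (rule that[OF d])
    fix h :: real assume h: "h \<noteq> 0" "\<bar>h\<bar> < d" and sub: "{a + h..b + h} \<subseteq> {\<alpha>..\<beta>}"
    have pt: "ennreal ((F (x + h) - F x - h * g x)\<^sup>2) \<le>
      ennreal (h\<^sup>2) * (\<integral>\<^sup>+\<theta>. ennreal ((g (x + h * \<theta>) - g x)\<^sup>2) * indicator {0..1} \<theta> \<partial>lborel)"
      if x: "x \<in> {a..b}" for x
    proof -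
      have "x + h \<in> {a + h..b + h}" using x by simp
      then have x': "x + h \<in> {\<alpha>..\<beta>}" using sub by blast
      have "((\<lambda>\<theta>. g (x + h * \<theta>)) has_integral (F (x + h) - F x) / h) {0..1}"
        using x ab by (intro has_integral_reparam_unit_interval[where \<alpha>=\<alpha> and \<beta>=\<beta>] FTC x' h) auto
      then have "((\<lambda>\<theta>. g (x + h * \<theta>) - g x) has_integral (F (x + h) - F x) / h - g x) {0..1}"
        using has_integral_const_real[of "g x" 0 1] by (intro has_integral_diff) auto
      from square_integral_unit_interval_le[OF _ this]
      have "ennreal (((F (x + h) - F x) / h - g x)\<^sup>2) \<le>
        (\<integral>\<^sup>+\<theta>. ennreal ((g (x + h * \<theta>) - g x)\<^sup>2) * indicator {0..1} \<theta> \<partial>lborel)" by simp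
      then have "ennreal (h\<^sup>2) * ennreal (((F (x + h) - F x) / h - g x)\<^sup>2) \<le>
        ennreal (h\<^sup>2) * (\<integral>\<^sup>+\<theta>. ennreal ((g (x + h * \<theta>) - g x)\<^sup>2) * indicator {0..1} \<theta> \<partial>lborel)"
        by (intro mult_left_mono) auto
      moreover have "ennreal (h\<^sup>2) * ennreal (((F (x + h) - F x) / h - g x)\<^sup>2) =
          ennreal ((F (x + h) - F x - h * g x)\<^sup>2)"
      proof -
        have "h * ((F (x + h) - F x) / h - g x) = F (x + h) - F x - h * g x"
          using h by (simp add: field_simps)
        from arg_cong[OF this, of power2]
        have "h\<^sup>2 * ((F (x + h) - F x) / h - g x)\<^sup>2 = (F (x + h) - F x - h * g x)\<^sup>2"
          by (simp only: power_mult_distrib)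
        then show ?thesis by (simp add: ennreal_mult[symmetric])
      qed
      ultimately show ?thesis by simp
    qed
    have "(\<integral>\<^sup>+x. ennreal ((F (x + h) - F x - h * g x)\<^sup>2) * indicator {a..b} x \<partial>lborel) \<le>
      (\<integral>\<^sup>+x. ennreal (h\<^sup>2) * (\<integral>\<^sup>+\<theta>. ennreal ((g (x + h * \<theta>) - g x)\<^sup>2) * indicator {0..1} \<theta> \<partial>lborel) \<partial>lborel)"
      using pt by (intro nn_integral_mono) (auto simp: indicator_def)
    also have "\<dots> = ennreal (h\<^sup>2) * (\<integral>\<^sup>+x. (\<integral>\<^sup>+\<theta>. ennreal ((g (x + h * \<theta>) - g x)\<^sup>2) * indicator {0..1} \<theta> \<partial>lborel) \<partial>lborel)"
      by (rule nn_integral_cmult) measurable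
    \<comment> \<open>Tonelli: for \<theta> in [0,1] the inner integral becomes the squared distance
      between g and its translate by h\<theta>, and |h\<theta>| < d.\<close>
    also have "(\<integral>\<^sup>+x. (\<integral>\<^sup>+\<theta>. ennreal ((g (x + h * \<theta>) - g x)\<^sup>2) * indicator {0..1} \<theta> \<partial>lborel) \<partial>lborel) =
      (\<integral>\<^sup>+\<theta>. (\<integral>\<^sup>+x. ennreal ((g (x + h * \<theta>) - g x)\<^sup>2) * indicator {0..1} \<theta> \<partial>lborel) \<partial>lborel)"
      by (rule lborel_pair.Fubini') measurable
    also have "\<dots> \<le> (\<integral>\<^sup>+\<theta>. ennreal \<epsilon> * indicator {0..1::real} \<theta> \<partial>lborel)"
    proof (rule nn_integral_mono)
      fix \<theta> :: real
      show "(\<integral>\<^sup>+x. ennreal ((g (x + h * \<theta>) - g x)\<^sup>2) * indicator {0..1} \<theta> \<partial>lborel) \<le> ennreal \<epsilon> * indicator {0..1} \<theta>"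
      proof (cases "\<theta> \<in> {0..1}")
        case True
        have "\<bar>h * \<theta>\<bar> \<le> \<bar>h\<bar> * 1" unfolding abs_mult using True by (intro mult_left_mono) auto
        then have "\<bar>h * \<theta>\<bar> < d" using h by simp
        from trans[OF this] True show ?thesis by simp
      qed simp
    qed
    also have "\<dots> = ennreal \<epsilon>" by (simp add: nn_integral_cmult)
    finally show "(\<integral>\<^sup>+x. ennreal ((F (x + h) - F x - h * g x)\<^sup>2) * indicator {a..b} x \<partial>lborel) \<le> ennreal (\<epsilon> * h\<^sup>2)"
      using e by (simp add: ennreal_mult mult.commute[of \<epsilon>] mult_left_mono)
  qed
qed

section \<open>From the DDF to the ODE-PDE\<close>

lemma L2_on_imp_integrable:
  assumes "L2_on {a..b} g"
  shows "integrable (lebesgue_on {a..b}) g"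
proof -
  interpret finite_measure "lebesgue_on {a..b}"
    by (rule finite_measure_lebesgue_on) auto
  show ?thesis
    using assms by (auto simp: L2_on_def intro: square_integrable_imp_integrable)
qed

text \<open>The translation estimates and Tonelli's theorem are applied to Borel functions and
  \<open>lborel\<close>, whereas \<open>L2_on\<close> provides Lebesgue measurability; the price of
  the change is a null set.\<close>

lemma L2_on_borel_version:
  assumes g: "L2_on {a..b} g"
  obtains g' :: "real \<Rightarrow> real" where "g' \<in> borel_measurable borel"
    "AE x in lebesgue_on {a..b}. g x = g' x"
proof -
  have "(\<lambda>x. indicat_real {a..b} x *\<^sub>R g x) \<in> borel_measurable lebesgue"
    using g by (subst (asm) L2_on_def, subst (asm) borel_measurable_restrict_space_iff) auto
  then obtain g' where g': "g' \<in> borel_measurable lborel"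
    and eq: "AE x in lborel. indicat_real {a..b} x *\<^sub>R g x = g' x"
    using completion_ex_borel_measurable_real by blast
  have "AE x in lebesgue. indicat_real {a..b} x *\<^sub>R g x = g' x"
    by (rule AE_completion[OF eq])
  then have "AE x in lebesgue_on {a..b}. g x = g' x"
    by (subst AE_restrict_space_iff) (auto elim: eventually_mono)
  then show ?thesis using g' that by auto
qed

lemma borel_measurable_lebesgue_on:
  "f \<in> borel_measurable borel \<Longrightarrow> f \<in> borel_measurable (lebesgue_on S)"
  by (intro measurable_restrict_space1 measurable_completion) simp

lemma L2_on_borel_iff:
  fixes g :: "real \<Rightarrow> real"
  assumes [measurable]: "g \<in> borel_measurable borel"
  shows "L2_on {a..b} g \<longleftrightarrow> (\<integral>\<^sup>+x. ennreal ((g x)\<^sup>2) * indicator {a..b} x \<partial>lborel) < \<infinity>"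
proof -
  have 1: "(\<integral>\<^sup>+x. ennreal ((g x)\<^sup>2) \<partial>lebesgue_on {a..b}) =
      (\<integral>\<^sup>+x. ennreal ((g x)\<^sup>2) * indicator {a..b} x \<partial>lborel)"
    by (subst nn_integral_restrict_space) (auto simp: nn_integral_completion)
  have "(\<lambda>x. (g x)\<^sup>2) \<in> borel_measurable (lebesgue_on {a..b})"
    by (rule borel_measurable_lebesgue_on) measurable
  then show ?thesis
    by (auto simp: L2_on_def borel_measurable_lebesgue_on integrable_iff_bounded 1)
qed

text \<open>F is absolutely continuous on [a,b] with density g in L2. Recording the increments over
  all subintervals makes restriction immediate and gluing easy; g is Borel on the whole line so that
  it can be translated.\<close>

definition L2_primitive :: "real \<Rightarrow> real \<Rightarrow> (real \<Rightarrow> real) \<Rightarrow> (real \<Rightarrow> real) \<Rightarrow> bool" where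
  "L2_primitive a b F g \<longleftrightarrow> g \<in> borel_measurable borel \<and> L2_on {a..b} g \<and>
     (\<forall>c d. a \<le> c \<longrightarrow> c \<le> d \<longrightarrow> d \<le> b \<longrightarrow> (g has_integral (F d - F c)) {c..d})"

lemma W12_on_imp_L2_primitive:
  assumes "a < b" and f: "W12_on {a..b} f"
  obtains g where "L2_primitive a b f g" "has_weak_deriv {a..b} f g"
proof -
  obtain g where g: "L2_on {a..b} g" and weak: "has_weak_deriv {a..b} f g"
    using f by (auto simp: W12_on_def)
  obtain g' where g': "g' \<in> borel_measurable borel" and eq: "AE x in lebesgue_on {a..b}. g x = g' x"
    using L2_on_borel_version[OF g] .
  have gm: "g \<in> borel_measurable (lebesgue_on {a..b})" using g by (simp add: L2_on_def)
  have g'm: "g' \<in> borel_measurable (lebesgue_on {a..b})"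
    by (rule borel_measurable_lebesgue_on[OF g'])
  have "integrable (lebesgue_on {a..b}) (\<lambda>s. (g s)\<^sup>2) = integrable (lebesgue_on {a..b}) (\<lambda>s. (g' s)\<^sup>2)"
    using eq gm g'm by (intro integrable_cong_AE) auto
  then have L2: "L2_on {a..b} g'" using g g'm by (simp add: L2_on_def)
  \<comment> \<open>The pairing with a test function does not see the null set on which g and
    \<open>g'\<close> differ.\<close>
  have weak': "has_weak_deriv {a..b} f g'"
    unfolding has_weak_deriv_def
  proof (intro allI impI, elim conjE exE)
    fix \<psi> \<psi>' :: "real \<Rightarrow> real" and C
    assume deriv: "\<forall>s. (\<psi> has_real_derivative \<psi>' s) (at s)" and cont: "continuous_on UNIV \<psi>'"
      and C: "compact C" "C \<subseteq> interior {a..b}" and supp: "\<forall>s. s \<notin> C \<longrightarrow> \<psi> s = 0"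
    have "(LINT s|lebesgue_on {a..b}. f s * \<psi>' s) = - (LINT s|lebesgue_on {a..b}. g s * \<psi> s)"
      by (rule has_weak_derivD[OF weak _ cont C]) (use deriv supp in auto)
    moreover have "\<psi> \<in> borel_measurable (lebesgue_on {a..b})"
      by (intro borel_measurable_lebesgue_on borel_measurable_continuous_onI DERIV_continuous_on)
         (use deriv in \<open>auto intro: has_field_derivative_at_within\<close>)
    then have "(LINT s|lebesgue_on {a..b}. g s * \<psi> s) = (LINT s|lebesgue_on {a..b}. g' s * \<psi> s)"
      using eq gm g'm by (intro integral_cong_AE) auto
    ultimately show "(LINT s|lebesgue_on {a..b}. f s * \<psi>' s) = - (LINT s|lebesgue_on {a..b}. g' s * \<psi> s)"
      by simp
  qed
  have "continuous_on {a..b} f" using f by (simp add: W12_on_def)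
  from weak_deriv_FTC[OF \<open>a < b\<close> this L2_on_imp_integrable[OF L2] weak']
  have "L2_primitive a b f g'" using g' L2 by (auto simp: L2_primitive_def)
  then show ?thesis using that weak' by auto
qed

text \<open>The pieces fit because F is one function whose value at b serves both; the density at
  the single point b does not affect an integral.\<close>

lemma L2_primitive_glue:
  assumes ab: "a \<le> b" "b \<le> c" and g1: "L2_primitive a b F g1" and g2: "L2_primitive b c F g2"
  shows "L2_primitive a c F (\<lambda>x. if x \<le> b then g1 x else g2 x)" (is "L2_primitive a c F ?g")
proof -
  have [measurable]: "g1 \<in> borel_measurable borel" "g2 \<in> borel_measurable borel"
    using g1 g2 by (auto simp: L2_primitive_def)
  have m: "?g \<in> borel_measurable borel" by measurable
  have fin: "(\<integral>\<^sup>+x. ennreal ((g1 x)\<^sup>2) * indicator {a..b} x \<partial>lborel) < \<infinity>"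
    "(\<integral>\<^sup>+x. ennreal ((g2 x)\<^sup>2) * indicator {b..c} x \<partial>lborel) < \<infinity>"
    using g1 g2 by (auto simp: L2_primitive_def L2_on_borel_iff)
  have "(\<integral>\<^sup>+x. ennreal ((?g x)\<^sup>2) * indicator {a..c} x \<partial>lborel) \<le>
     (\<integral>\<^sup>+x. ennreal ((g1 x)\<^sup>2) * indicator {a..b} x + ennreal ((g2 x)\<^sup>2) * indicator {b..c} x \<partial>lborel)"
    by (intro nn_integral_mono) (auto simp: indicator_def)
  also have "\<dots> = (\<integral>\<^sup>+x. ennreal ((g1 x)\<^sup>2) * indicator {a..b} x \<partial>lborel) +
     (\<integral>\<^sup>+x. ennreal ((g2 x)\<^sup>2) * indicator {b..c} x \<partial>lborel)"
    by (rule nn_integral_add) measurable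
  also have "\<dots> < \<infinity>" using fin by (simp add: less_top)
  finally have L2: "L2_on {a..c} ?g" using L2_on_borel_iff[OF m] by simp
  have left: "(?g has_integral (F y - F x)) {x..y}" if "a \<le> x" "x \<le> y" "y \<le> b" for x y
    using has_integral_eq[of "{x..y}" g1 ?g] g1 that by (auto simp: L2_primitive_def)
  have right: "(?g has_integral (F y - F x)) {x..y}" if "b \<le> x" "x \<le> y" "y \<le> c" for x y
  proof (rule has_integral_spike_finite[of "{b}" _ _ g2])
    show "(g2 has_integral (F y - F x)) {x..y}" using g2 that by (auto simp: L2_primitive_def)
  qed (use that in auto)
  have "(?g has_integral (F y - F x)) {x..y}" if "a \<le> x" "x \<le> y" "y \<le> c" for x y
  proof -
    consider "y \<le> b" | "b \<le> x" | "x \<le> b" "b \<le> y" by linarith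
    then show ?thesis
    proof cases
      case 3
      then show ?thesis
        using has_integral_combine[OF 3 left[of x b] right[of b y]] that by simp
    qed (use left right that in auto)
  qed
  then show ?thesis using m L2 by (simp add: L2_primitive_def)
qed

lemma L2_primitive_subinterval:
  assumes g: "L2_primitive a b F g" and sub: "a \<le> a'" "b' \<le> b"
  shows "L2_primitive a' b' F g"
proof -
  have gm: "g \<in> borel_measurable borel" using g by (simp add: L2_primitive_def)
  have "(\<integral>\<^sup>+x. ennreal ((g x)\<^sup>2) * indicator {a'..b'} x \<partial>lborel) \<le>
      (\<integral>\<^sup>+x. ennreal ((g x)\<^sup>2) * indicator {a..b} x \<partial>lborel)"
    by (intro nn_integral_mono) (use sub in \<open>auto simp: indicator_def\<close>)
  also have "\<dots> < \<infinity>" using g L2_on_borel_iff[OF gm] by (simp add: L2_primitive_def)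
  finally have "L2_on {a'..b'} g" using L2_on_borel_iff[OF gm] by simp
  then show ?thesis using g sub by (auto simp: L2_primitive_def)
qed

lemma W12_window_shift:
  assumes "W12_on {- \<tau>..0} (\<lambda>s. F (t + s))"
  shows "W12_on {t - \<tau>..t} F"
  using W12_on_affine_Icc[of 1 "- t" "t - \<tau>" t "\<lambda>s. F (t + s)"] assms by simp

text \<open>The windows at t = 0, \<tau>, 2\<tau>, ... tile [-\<tau>, n\<tau>], neighbours sharing
  an end point. The L2 norms of the pieces need not be square summable, hence the finite
  horizon.\<close>

lemma W12_windows_imp_L2_primitive:
  assumes "0 < \<tau>" and win: "\<And>t. 0 \<le> t \<Longrightarrow> W12_on {- \<tau>..0} (\<lambda>s. F (t + s))"
  shows "\<exists>g. L2_primitive (- \<tau>) (real n * \<tau>) F g"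
proof (induction n)
  case 0
  show ?case
    using W12_on_imp_L2_primitive[OF _ W12_window_shift[OF win[of 0]]] \<open>0 < \<tau>\<close> by auto
next
  case (Suc n)
  obtain g1 where g1: "L2_primitive (- \<tau>) (real n * \<tau>) F g1" using Suc by auto
  have "W12_on {real n * \<tau>..real (Suc n) * \<tau>} F"
    using W12_window_shift[OF win[of "real (Suc n) * \<tau>"]] \<open>0 < \<tau>\<close> by (simp add: distrib_right)
  then obtain g2 where g2: "L2_primitive (real n * \<tau>) (real (Suc n) * \<tau>) F g2"
    using W12_on_imp_L2_primitive[of "real n * \<tau>" "real (Suc n) * \<tau>" F] \<open>0 < \<tau>\<close>
    by (auto simp: distrib_right)
  have "- \<tau> \<le> real n * \<tau>" using \<open>0 < \<tau>\<close> by (rule_tac order_trans[of _ 0]) auto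
  then show ?case
    using L2_primitive_glue[OF _ _ g1 g2] \<open>0 < \<tau>\<close> by (auto simp: distrib_right)
qed

text \<open>With x = t + \<tau> s and h = t' - t the increment in time at fixed s is F(x + h) -
  F(x), so this is the L2 difference quotient of F on [t - \<tau>, t]. The strict t < \<beta> leaves
  room for h > 0; for h < 0 the bound t' \<ge> 0 keeps the shifted window right of -\<tau>.\<close>

lemma transport_difference_quotient:
  assumes tau: "0 < \<tau>" and prim: "L2_primitive (- \<tau>) \<beta> F g"
    and t0: "0 \<le> t" "t < \<beta>" and e: "0 < \<epsilon>"
  shows "\<forall>\<^sub>F t' in at t within {0..}.
    (\<integral>\<^sup>+s. ennreal ((F (t' + \<tau> * s) - F (t + \<tau> * s) - (t' - t) * g (t + \<tau> * s))\<^sup>2)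
       \<partial>lebesgue_on {- 1..0}) \<le> ennreal (\<epsilon> * (t' - t)\<^sup>2)"
proof -
  define \<alpha> where \<alpha>: "\<alpha> = - \<tau>"
  have g: "L2_primitive \<alpha> \<beta> F g" and t: "\<alpha> \<le> t - \<tau>" "t < \<beta>"
    using prim t0 by (auto simp: \<alpha>)
  have gm[measurable]: "g \<in> borel_measurable borel" and gL: "L2_on {\<alpha>..\<beta>} g"
    and FTC: "\<And>c d. \<alpha> \<le> c \<Longrightarrow> c \<le> d \<Longrightarrow> d \<le> \<beta> \<Longrightarrow> (g has_integral (F d - F c)) {c..d}"
    using g by (auto simp: L2_primitive_def)
  \<comment> \<open>Cut off outside [\<alpha>,\<beta>]: the translation estimate asks for square
    integrability on the whole line.\<close>
  define G where "G = (\<lambda>x. indicator {\<alpha>..\<beta>} x * g x)"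
  have [measurable]: "G \<in> borel_measurable borel" unfolding G_def by measurable
  have "(\<integral>\<^sup>+x. ennreal ((G x)\<^sup>2) \<partial>lborel) = (\<integral>\<^sup>+x. ennreal ((g x)\<^sup>2) * indicator {\<alpha>..\<beta>} x \<partial>lborel)"
    by (intro nn_integral_cong) (auto simp: G_def indicator_def)
  then have fin: "(\<integral>\<^sup>+x. ennreal ((G x)\<^sup>2) \<partial>lborel) < \<infinity>"
    using gL L2_on_borel_iff[OF gm] by simp
  have GFTC: "(G has_integral (F d - F c)) {c..d}" if "\<alpha> \<le> c" "c \<le> d" "d \<le> \<beta>" for c d
    by (rule has_integral_eq[OF _ FTC[OF that]]) (use that in \<open>auto simp: G_def\<close>)
  \<comment> \<open>The tolerance is \<epsilon>\<tau> because the substitution x = t + \<tau> s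
    brings in a factor \<tau>, cancelled at the end.\<close>
  obtain d where d: "0 < d" and est: "\<And>h. h \<noteq> 0 \<Longrightarrow> \<bar>h\<bar> < d \<Longrightarrow> {t - \<tau> + h..t + h} \<subseteq> {\<alpha>..\<beta>} \<Longrightarrow>
    (\<integral>\<^sup>+x. ennreal ((F (x + h) - F x - h * G x)\<^sup>2) * indicator {t - \<tau>..t} x \<partial>lborel) \<le> ennreal (\<epsilon> * \<tau> * h\<^sup>2)"
    by (rule difference_quotient_L2[of G \<alpha> \<beta> F "t - \<tau>" t "\<epsilon> * \<tau>"])
       (use t tau e fin GFTC in auto)
  show ?thesis
    unfolding eventually_at
  proof (intro exI[of _ "min d (\<beta> - t)"] conjI ballI impI)
    fix t' assume t': "t' \<in> {0..}" "t' \<noteq> t \<and> dist t' t < min d (\<beta> - t)"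
    define h where "h = t' - t"
    have h: "h \<noteq> 0" "\<bar>h\<bar> < d" "h < \<beta> - t" "0 \<le> t + h"
      using t' by (auto simp: h_def dist_real_def)
    define q where "q = (\<lambda>x. (F (x + h) - F x - h * G x) * indicator {t - \<tau>..t} x)"
    have q_eq: "indicator {t - \<tau>..t} (t + \<tau> * s) = (indicator {- 1..0} s :: real)" for s
      using indicator_affine_Icc[OF tau, of t "- 1" 0 s] by simp
    have "(\<integral>\<^sup>+s. ennreal ((F (t' + \<tau> * s) - F (t + \<tau> * s) - (t' - t) * g (t + \<tau> * s))\<^sup>2)
       \<partial>lebesgue_on {- 1..0}) =
       (\<integral>\<^sup>+s. ennreal ((F (t' + \<tau> * s) - F (t + \<tau> * s) - (t' - t) * g (t + \<tau> * s))\<^sup>2) * indicator {- 1..0} s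
       \<partial>lebesgue)"
      by (subst nn_integral_restrict_space) auto
    also have "\<dots> = (\<integral>\<^sup>+s. ennreal ((q (t + \<tau> * s))\<^sup>2) \<partial>lebesgue)"
    proof (rule nn_integral_cong)
      fix s :: real
      show "ennreal ((F (t' + \<tau> * s) - F (t + \<tau> * s) - (t' - t) * g (t + \<tau> * s))\<^sup>2) * indicator {- 1..0} s =
        ennreal ((q (t + \<tau> * s))\<^sup>2)"
      proof (cases "s \<in> {- 1..0}")
        case True
        then have "- \<tau> \<le> \<tau> * s" "\<tau> * s \<le> 0" using tau mult_left_mono[of "- 1" s \<tau>]
          by (auto simp: mult_nonneg_nonpos)
        then have "t + \<tau> * s \<in> {\<alpha>..\<beta>}" using t by auto
        then have "q (t + \<tau> * s) = F (t' + \<tau> * s) - F (t + \<tau> * s) - (t' - t) * g (t + \<tau> * s)"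
          using True q_eq[of s] by (simp add: q_def G_def h_def algebra_simps)
        then show ?thesis using True by simp
      next
        case False
        then show ?thesis by (simp add: q_def q_eq)
      qed
    qed
    finally have 1: "(\<integral>\<^sup>+s. ennreal ((F (t' + \<tau> * s) - F (t + \<tau> * s) - (t' - t) * g (t + \<tau> * s))\<^sup>2)
       \<partial>lebesgue_on {- 1..0}) = (\<integral>\<^sup>+s. ennreal ((q (t + \<tau> * s))\<^sup>2) \<partial>lebesgue)" .
    have Fc: "continuous_on {\<alpha>..\<beta>} F"
    proof -
      have "continuous_on {\<alpha>..\<beta>} (\<lambda>x. F \<alpha> + integral {\<alpha>..x} g)"
        by (intro continuous_intros indefinite_integral_continuous_1)
           (use FTC[of \<alpha> \<beta>] t tau in auto)
      moreover have "F \<alpha> + integral {\<alpha>..x} g = F x" if "x \<in> {\<alpha>..\<beta>}" for x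
        using integral_unique[OF FTC[of \<alpha> x]] that by auto
      ultimately show ?thesis by (rule continuous_on_eq)
    qed
    have wsub: "{t - \<tau> + h..t + h} \<subseteq> {\<alpha>..\<beta>}" using h t tau \<alpha> by auto
    \<comment> \<open>F is controlled on [\<alpha>,\<beta>] alone, so measurability comes from
      continuity on the window combined with its indicator.\<close>
    have q_m[measurable]: "q \<in> borel_measurable borel"
    proof -
      have "x + h \<in> {\<alpha>..\<beta>}" if "x \<in> {t - \<tau>..t}" for x
        using that by (intro subsetD[OF wsub]) auto
      then have "continuous_on {t - \<tau>..t} (\<lambda>x. F (x + h))"
        by (intro continuous_on_compose2[OF Fc, of _ "\<lambda>x. x + h"] continuous_intros) auto
      moreover have "continuous_on {t - \<tau>..t} F"
        by (rule continuous_on_subset[OF Fc]) (use t in auto)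
      ultimately have "(\<lambda>x. indicat_real {t - \<tau>..t} x *\<^sub>R (F (x + h) - F x)) \<in> borel_measurable borel"
        by (intro borel_measurable_continuous_on_indicator continuous_on_diff) auto
      then have "(\<lambda>x. indicat_real {t - \<tau>..t} x *\<^sub>R (F (x + h) - F x) - h * G x * indicator {t - \<tau>..t} x) \<in> borel_measurable borel"
        by measurable
      then show ?thesis by (simp add: q_def algebra_simps)
    qed
    have "(\<integral>\<^sup>+s. ennreal ((q (t + \<tau> * s))\<^sup>2) \<partial>lebesgue) = (\<integral>\<^sup>+s. ennreal ((q (t + \<tau> * s))\<^sup>2) \<partial>lborel)"
      by (rule nn_integral_completion)
    also have "ennreal \<tau> * \<dots> = (\<integral>\<^sup>+x. ennreal ((q x)\<^sup>2) \<partial>lborel)"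
      using nn_integral_real_affine[of "\<lambda>x. ennreal ((q x)\<^sup>2)" \<tau> t] tau by simp
    also have "\<dots> = (\<integral>\<^sup>+x. ennreal ((F (x + h) - F x - h * G x)\<^sup>2) * indicator {t - \<tau>..t} x \<partial>lborel)"
      by (intro nn_integral_cong) (auto simp: q_def indicator_def)
    also have "\<dots> \<le> ennreal (\<epsilon> * \<tau> * h\<^sup>2)"
      by (rule est[OF h(1,2) wsub])
    also have "\<dots> = ennreal \<tau> * ennreal (\<epsilon> * h\<^sup>2)"
      using tau e by (simp add: ennreal_mult[symmetric] ac_simps)
    finally have "ennreal \<tau> * (\<integral>\<^sup>+s. ennreal ((q (t + \<tau> * s))\<^sup>2) \<partial>lebesgue) \<le> ennreal \<tau> * ennreal (\<epsilon> * h\<^sup>2)" .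
    then have "(\<integral>\<^sup>+s. ennreal ((q (t + \<tau> * s))\<^sup>2) \<partial>lebesgue) \<le> ennreal (\<epsilon> * h\<^sup>2)"
      using tau by (subst (asm) ennreal_mult_le_mult_iff) auto
    then show "(\<integral>\<^sup>+s. ennreal ((F (t' + \<tau> * s) - F (t + \<tau> * s) - (t' - t) * g (t + \<tau> * s))\<^sup>2)
       \<partial>lebesgue_on {- 1..0}) \<le> ennreal (\<epsilon> * (t' - t)\<^sup>2)"
      unfolding 1 h_def .
  qed (use d t in auto)
qed

text \<open>The density g of F on [-\<tau>,T] and the weak derivative \<open>g1\<close> on
  [t - \<tau>, t] are obtained separately. Splicing \<open>g1\<close> into g gives a density
  \<gamma> of F, so that \<gamma>(t + \<tau> s) is the time derivative and agrees almost everywhere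
  with 1/\<tau> times the weak s-derivative \<tau> g1(t + \<tau> s).\<close>

lemma transport_solution_channel:
  assumes tau: "0 < \<tau>" and win: "\<And>t. 0 \<le> t \<Longrightarrow> W12_on {- \<tau>..0} (\<lambda>s. F (t + s))" and t: "0 \<le> t"
  obtains D G where "L2_on {- 1..0} D" "L2_on {- 1..0} G" "has_weak_deriv {- 1..0} (\<lambda>s. F (t + \<tau> * s)) G"
    "AE s in lebesgue_on {- 1..0}. D s = 1 / \<tau> * G s"
    "\<And>\<epsilon>. 0 < \<epsilon> \<Longrightarrow> \<forall>\<^sub>F t' in at t within {0..}.
      (\<integral>\<^sup>+s. ennreal ((F (t' + \<tau> * s) - F (t + \<tau> * s) - (t' - t) * D s)\<^sup>2)
       \<partial>lebesgue_on {- 1..0}) \<le> ennreal (\<epsilon> * (t' - t)\<^sup>2)"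
proof -
  obtain n where n: "t / \<tau> < real n" using reals_Archimedean2 by blast
  define T where "T = real n * \<tau>"
  have T: "t < T" using n tau by (simp add: T_def field_simps)
  obtain g where g: "L2_primitive (- \<tau>) T F g"
    using W12_windows_imp_L2_primitive[OF tau win] unfolding T_def by blast
  obtain g1 where g1: "L2_primitive (t - \<tau>) t F g1" and weak: "has_weak_deriv {t - \<tau>..t} F g1"
    using W12_on_imp_L2_primitive[OF _ W12_window_shift[OF win[OF t]]] tau by auto
  define \<gamma> where "\<gamma> = (\<lambda>x. if x \<le> t then (if x \<le> t - \<tau> then g x else g1 x) else g x)"
  have \<gamma>: "L2_primitive (- \<tau>) T F \<gamma>"
    unfolding \<gamma>_def using t tau T
    by (intro L2_primitive_glue g1 L2_primitive_subinterval[OF g]) auto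
  have "L2_on {t - \<tau>..t} \<gamma>"
    using L2_primitive_subinterval[OF \<gamma>, of "t - \<tau>" t] t tau T by (simp add: L2_primitive_def)
  then have D: "L2_on {- 1..0} (\<lambda>s. \<gamma> (t + \<tau> * s))"
    using L2_on_affine_Icc[OF tau, of t "- 1" 0 \<gamma>] by simp
  have "L2_on {- 1..0} (\<lambda>s. g1 (t + \<tau> * s))"
    using L2_on_affine_Icc[OF tau, of t "- 1" 0 g1] g1 by (simp add: L2_primitive_def)
  then have G: "L2_on {- 1..0} (\<lambda>s. \<tau> * g1 (t + \<tau> * s))"
    by (auto simp: L2_on_def power_mult_distrib)
  have weak': "has_weak_deriv {- 1..0} (\<lambda>s. F (t + \<tau> * s)) (\<lambda>s. \<tau> * g1 (t + \<tau> * s))"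
    using has_weak_deriv_affine_Icc[OF tau, of t "- 1" 0 F g1] weak by simp
  \<comment> \<open>At s = -1 the spliced density still takes its value from g; this is the one
    exceptional point.\<close>
  have "AE s in lebesgue. s \<noteq> - 1"
    by (rule AE_completion) (rule AE_lborel_singleton)
  then have "AE s in lebesgue. s \<in> {- 1..0} \<longrightarrow> \<gamma> (t + \<tau> * s) = 1 / \<tau> * (\<tau> * g1 (t + \<tau> * s))"
  proof eventually_elim
    case (elim s)
    show ?case
    proof
      assume "s \<in> {- 1..0}"
      then have "\<tau> * s \<le> 0" "\<tau> * (- 1) < \<tau> * s"
        using tau elim mult_strict_left_mono[of "- 1" s \<tau>] by (auto simp: mult_nonneg_nonpos)
      then show "\<gamma> (t + \<tau> * s) = 1 / \<tau> * (\<tau> * g1 (t + \<tau> * s))"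
        using tau by (auto simp: \<gamma>_def)
    qed
  qed
  then have "AE s in lebesgue_on {- 1..0}. \<gamma> (t + \<tau> * s) = 1 / \<tau> * (\<tau> * g1 (t + \<tau> * s))"
    by (subst AE_restrict_space_iff) auto
  then show ?thesis
    by (rule that[OF D G weak']) (rule transport_difference_quotient[OF tau \<gamma> t T])
qed

lemma has_L2_derivativeI:
  assumes D: "\<And>k. k < d \<Longrightarrow> L2_on S (\<lambda>s. D s k)"
    and meas: "\<And>k t'. k < d \<Longrightarrow> 0 \<le> t' \<Longrightarrow> (\<lambda>s. \<phi> t' s k) \<in> borel_measurable (lebesgue_on S)" and "0 \<le> t"
    and est: "\<And>k \<epsilon>. k < d \<Longrightarrow> 0 < \<epsilon> \<Longrightarrow> \<forall>\<^sub>F t' in at t within {0..}.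
      (\<integral>\<^sup>+s. ennreal ((\<phi> t' s k - \<phi> t s k - (t' - t) * D s k)\<^sup>2) \<partial>lebesgue_on S) \<le> ennreal (\<epsilon> * (t' - t)\<^sup>2)"
  shows "has_L2_derivative d S \<phi> D t"
  unfolding has_L2_derivative_def
proof (intro conjI allI impI D)
  show "((\<lambda>t'. L2_norm d S (\<lambda>s k. \<phi> t' s k - \<phi> t s k - (t' - t) * D s k) / \<bar>t' - t\<bar>) \<longlongrightarrow> 0)
     (at t within {0..})"
  proof (rule tendstoI)
    fix r :: real assume r: "0 < r"
    \<comment> \<open>The denominator d + 1 makes d * \<epsilon> strictly smaller than r^2, also for
      d = 0.\<close>
    define \<epsilon> where "\<epsilon> = r\<^sup>2 / (real d + 1)"
    have \<epsilon>: "0 < \<epsilon>" "real d * \<epsilon> < r\<^sup>2" using r by (auto simp: \<epsilon>_def field_simps)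
    have "\<forall>\<^sub>F t' in at t within {0..}. \<forall>k\<in>{..<d}.
      (\<integral>\<^sup>+s. ennreal ((\<phi> t' s k - \<phi> t s k - (t' - t) * D s k)\<^sup>2) \<partial>lebesgue_on S) \<le> ennreal (\<epsilon> * (t' - t)\<^sup>2)"
      using est \<epsilon> by (intro eventually_ball_finite) auto
    moreover have "\<forall>\<^sub>F t' in at t within {0..}. t' \<noteq> t \<and> t' \<in> {0..}"
      by (simp add: eventually_at_filter)
    ultimately show "\<forall>\<^sub>F t' in at t within {0..}.
      dist (L2_norm d S (\<lambda>s k. \<phi> t' s k - \<phi> t s k - (t' - t) * D s k) / \<bar>t' - t\<bar>) 0 < r"
    proof eventually_elim
      case (elim t')
      let ?e = "\<lambda>k s. \<phi> t' s k - \<phi> t s k - (t' - t) * D s k"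
      have em: "?e k \<in> borel_measurable (lebesgue_on S)" if "k < d" for k
        using meas[OF that, of t'] meas[OF that, of t] D[OF that] elim \<open>0 \<le> t\<close>
        by (auto simp: L2_on_def)
      have "(\<integral>\<^sup>+s. ennreal (\<Sum>k<d. (?e k s)\<^sup>2) \<partial>lebesgue_on S) =
        (\<integral>\<^sup>+s. (\<Sum>k<d. ennreal ((?e k s)\<^sup>2)) \<partial>lebesgue_on S)"
        by (simp add: sum_ennreal)
      also have "\<dots> = (\<Sum>k<d. \<integral>\<^sup>+s. ennreal ((?e k s)\<^sup>2) \<partial>lebesgue_on S)"
        using em by (intro nn_integral_sum) auto
      also have "\<dots> \<le> (\<Sum>k<d. ennreal (\<epsilon> * (t' - t)\<^sup>2))"
        using elim by (intro sum_mono) auto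
      also have "\<dots> = ennreal (real d * \<epsilon> * (t' - t)\<^sup>2)"
        using \<epsilon> by (simp add: ennreal_mult ennreal_of_nat_eq_real_of_nat mult.assoc)
      finally have "(LINT s|lebesgue_on S. (\<Sum>k<d. (?e k s)\<^sup>2)) \<le> real d * \<epsilon> * (t' - t)\<^sup>2"
        using \<epsilon> by (intro integral_real_bounded) auto
      also have "\<dots> < r\<^sup>2 * (t' - t)\<^sup>2"
        using \<epsilon> elim by (intro mult_strict_right_mono) auto
      finally have "L2_norm d S (\<lambda>s k. ?e k s) < sqrt (r\<^sup>2 * (t' - t)\<^sup>2)"
        by (simp add: L2_norm_def)
      then have "L2_norm d S (\<lambda>s k. ?e k s) < r * \<bar>t' - t\<bar>"
        using r by (simp add: real_sqrt_mult)
      moreover have "0 \<le> L2_norm d S (\<lambda>s k. ?e k s)"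
        unfolding L2_norm_def by (intro real_sqrt_ge_zero integral_nonneg_AE AE_I2 sum_nonneg) auto
      ultimately show ?case
        using elim by (simp add: dist_real_def field_simps)
    qed
  qed
qed

theorem satisfies_DDF_imp_ODE_PDE:
  assumes tau: "\<forall>i\<in>{1..K S}. 0 < tau S i" and ddf: "satisfies_DDF S u w x0 r0 x r v y z"
  shows "satisfies_ODE_PDE S u w x0 (\<lambda>i s. r0 i (tau S i * s)) x (\<lambda>i t s. r i (t + tau S i * s)) v y z"
proof -
  have r0: "\<And>i k. i \<in> {1..K S} \<Longrightarrow> k < dimr S i \<Longrightarrow> W12_on {- tau S i..0} (\<lambda>s. r0 i s k) \<and>
        r0 i 0 k = mult_rows (Cr S i) x0 k + mult_rows (Drv S i) (ddf_delay S r0) k"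
    and init: "\<And>i s k. i \<in> {1..K S} \<Longrightarrow> s \<in> {- tau S i..0} \<Longrightarrow> k < dimr S i \<Longrightarrow> r i s k = r0 i s k"
    and win: "\<And>t i k. 0 \<le> t \<Longrightarrow> i \<in> {1..K S} \<Longrightarrow> k < dimr S i \<Longrightarrow> W12_on {- tau S i..0} (\<lambda>s. r i (t + s) k)"
    and v: "\<And>t. 0 \<le> t \<Longrightarrow> v t = ddf_delay S (\<lambda>i s. r i (t + s))"
    and rest: "x 0 = x0" "block_equation S u w x r v y z"
    using ddf unfolding satisfies_DDF_def by blast+
  have scale: "W12_on {- 1..0} (\<lambda>s. f (tau S i * s))" if "i \<in> {1..K S}" "W12_on {- tau S i..0} f" for i f
    using W12_on_affine_Icc[of "tau S i" 0 "- 1" 0 f] that tau by simp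
  have win': "W12_on {- 1..0} (\<lambda>s. r i (t + tau S i * s) k)"
    if "0 \<le> t" "i \<in> {1..K S}" "k < dimr S i" for t i k
    using scale[OF that(2) win[OF that]] .
  have "\<exists>D G. has_L2_derivative (dimr S i) {- 1..0} (\<lambda>t s. r i (t + tau S i * s)) D t \<and>
        (\<forall>k<dimr S i. L2_on {- 1..0} (\<lambda>s. G s k) \<and>
           has_weak_deriv {- 1..0} (\<lambda>s. r i (t + tau S i * s) k) (\<lambda>s. G s k)) \<and>
        (AE s in lebesgue_on {- 1..0}. \<forall>k<dimr S i. D s k = 1 / tau S i * G s k)"
    if t: "0 \<le> t" and i: "i \<in> {1..K S}" for t i
  proof -
    have taui: "0 < tau S i" using tau i by auto
    \<comment> \<open>Pairs, because D and G of one component have to be chosen together;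
      \<open>bchoice\<close> then assembles the scalar choices into vectors.\<close>
    have "\<forall>k\<in>{..<dimr S i}. \<exists>DG. L2_on {- 1..0} (fst DG) \<and> L2_on {- 1..0} (snd DG) \<and>
        has_weak_deriv {- 1..0} (\<lambda>s. r i (t + tau S i * s) k) (snd DG) \<and>
        (AE s in lebesgue_on {- 1..0}. fst DG s = 1 / tau S i * snd DG s) \<and>
        (\<forall>\<epsilon>>0. \<forall>\<^sub>F t' in at t within {0..}.
          (\<integral>\<^sup>+s. ennreal ((r i (t' + tau S i * s) k - r i (t + tau S i * s) k - (t' - t) * fst DG s)\<^sup>2)
            \<partial>lebesgue_on {- 1..0}) \<le> ennreal (\<epsilon> * (t' - t)\<^sup>2))"
    proof
      fix k assume "k \<in> {..<dimr S i}"
      then have "W12_on {- tau S i..0} (\<lambda>s. r i (t + s) k)" if "0 \<le> t" for t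
        using win[OF that i] by simp
      from transport_solution_channel[OF taui this t]
      obtain D G where "L2_on {- 1..0} D" "L2_on {- 1..0} G"
        "has_weak_deriv {- 1..0} (\<lambda>s. r i (t + tau S i * s) k) G"
        "AE s in lebesgue_on {- 1..0}. D s = 1 / tau S i * G s"
        "\<And>\<epsilon>. 0 < \<epsilon> \<Longrightarrow> \<forall>\<^sub>F t' in at t within {0..}.
          (\<integral>\<^sup>+s. ennreal ((r i (t' + tau S i * s) k - r i (t + tau S i * s) k - (t' - t) * D s)\<^sup>2)
            \<partial>lebesgue_on {- 1..0}) \<le> ennreal (\<epsilon> * (t' - t)\<^sup>2)"
        by blast
      then show "\<exists>DG. L2_on {- 1..0} (fst DG) \<and> L2_on {- 1..0} (snd DG) \<and>
        has_weak_deriv {- 1..0} (\<lambda>s. r i (t + tau S i * s) k) (snd DG) \<and>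
        (AE s in lebesgue_on {- 1..0}. fst DG s = 1 / tau S i * snd DG s) \<and>
        (\<forall>\<epsilon>>0. \<forall>\<^sub>F t' in at t within {0..}.
          (\<integral>\<^sup>+s. ennreal ((r i (t' + tau S i * s) k - r i (t + tau S i * s) k - (t' - t) * fst DG s)\<^sup>2)
            \<partial>lebesgue_on {- 1..0}) \<le> ennreal (\<epsilon> * (t' - t)\<^sup>2))"
        by (intro exI[of _ "(D, G)"]) simp
    qed
    from bchoice[OF this] obtain DG where DG: "\<And>k. k < dimr S i \<Longrightarrow>
        L2_on {- 1..0} (fst (DG k)) \<and> L2_on {- 1..0} (snd (DG k)) \<and>
        has_weak_deriv {- 1..0} (\<lambda>s. r i (t + tau S i * s) k) (snd (DG k)) \<and>
        (AE s in lebesgue_on {- 1..0}. fst (DG k) s = 1 / tau S i * snd (DG k) s) \<and>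
        (\<forall>\<epsilon>>0. \<forall>\<^sub>F t' in at t within {0..}.
          (\<integral>\<^sup>+s. ennreal ((r i (t' + tau S i * s) k - r i (t + tau S i * s) k - (t' - t) * fst (DG k) s)\<^sup>2)
            \<partial>lebesgue_on {- 1..0}) \<le> ennreal (\<epsilon> * (t' - t)\<^sup>2))"
      by auto
    have "has_L2_derivative (dimr S i) {- 1..0} (\<lambda>t s. r i (t + tau S i * s)) (\<lambda>s k. fst (DG k) s) t"
    proof (rule has_L2_derivativeI[OF _ _ t])
      show "(\<lambda>s. r i (t' + tau S i * s) k) \<in> borel_measurable (lebesgue_on {- 1..0})"
        if "k < dimr S i" "0 \<le> t'" for k t'
        using win'[OF that(2) i that(1)] by (simp add: W12_on_def L2_on_def)
    qed (use DG in auto)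
    \<comment> \<open>The exceptional set depends on k; a finite union of null sets is null.\<close>
    moreover have "AE s in lebesgue_on {- 1..0}. \<forall>k\<in>{..<dimr S i}. fst (DG k) s = 1 / tau S i * snd (DG k) s"
      using DG by (intro AE_finite_allI) auto
    ultimately show ?thesis
      using DG by (intro exI[of _ "\<lambda>s k. fst (DG k) s"] exI[of _ "\<lambda>s k. snd (DG k) s"]) auto
  qed
  moreover have "v t = pde_delay S (\<lambda>i s. r i (t + tau S i * s))" if "0 \<le> t" for t
    unfolding v[OF that] by (intro ddf_delay_rescale tau) auto
  moreover have "ddf_delay S r0 = pde_delay S (\<lambda>i s. r0 i (tau S i * s))"
    by (intro ddf_delay_rescale tau) auto
  then have "W12_on {- 1..0} (\<lambda>s. r0 i (tau S i * s) k) \<and>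
      r0 i (tau S i * 0) k = mult_rows (Cr S i) x0 k +
        mult_rows (Drv S i) (pde_delay S (\<lambda>i s. r0 i (tau S i * s))) k"
    if "i \<in> {1..K S}" "k < dimr S i" for i k
    using r0[OF that] scale[OF that(1), of "\<lambda>s. r0 i s k"] by simp
  moreover have "r i (0 + tau S i * s) k = r0 i (tau S i * s) k"
    if "i \<in> {1..K S}" "s \<in> {- 1..0}" "k < dimr S i" for i s k
  proof -
    have taui: "0 < tau S i" using tau that(1) by auto
    then have "tau S i * s \<in> {- tau S i..0}"
      using that(2) mult_left_mono[of "- 1" s "tau S i"] by (auto simp: mult_nonneg_nonpos)
    then show ?thesis using init[OF that(1) _ that(3)] by simp
  qed
  moreover have "block_equation S u w x (\<lambda>i t. r i (t + tau S i * 0)) v y z"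
    using rest(2) by simp
  ultimately show ?thesis
    using win' rest(1) unfolding satisfies_ODE_PDE_def by blast
qed

section \<open>From the ODE-PDE to the DDF\<close>

text \<open>Since [-1,0] has length 1, the mean m of |e| is at most its L2 norm: expand the integral
  of (|e| - m)^2, which is nonnegative. The bound |\<psi>| \<le> 1 does the rest.\<close>

lemma abs_integral_mult_le_L2:
  fixes e \<psi> :: "real \<Rightarrow> real"
  assumes e: "L2_on {- 1..0} e" and \<psi>: "\<psi> \<in> borel_measurable (lebesgue_on {- 1..0})" "\<And>s. \<bar>\<psi> s\<bar> \<le> 1"
  shows "\<bar>LINT s|lebesgue_on {- 1..0}. e s * \<psi> s\<bar> \<le> sqrt (LINT s|lebesgue_on {- 1..0}. (e s)\<^sup>2)"
proof -
  define m where "m = (LINT s|lebesgue_on {- 1..0}. \<bar>e s\<bar>)"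
  have em: "e \<in> borel_measurable (lebesgue_on {- 1..0})"
    and int2: "integrable (lebesgue_on {- 1..0}) (\<lambda>s. (e s)\<^sup>2)"
    using e by (auto simp: L2_on_def)
  have int: "integrable (lebesgue_on {- 1..0}) (\<lambda>s. \<bar>e s\<bar>)"
    using L2_on_imp_integrable[OF e] by simp
  have one: "integrable (lebesgue_on {- 1..0}) (\<lambda>s::real. m\<^sup>2)"
    "(LINT s|lebesgue_on {- 1..0::real}. m\<^sup>2) = m\<^sup>2"
    by (auto simp: measure_restrict_space intro!: continuous_imp_integrable_real)
  have "0 \<le> (LINT s|lebesgue_on {- 1..0}. (\<bar>e s\<bar> - m)\<^sup>2)"
    by (intro integral_nonneg_AE AE_I2) simp
  also have "\<dots> = (LINT s|lebesgue_on {- 1..0}. (e s)\<^sup>2 - 2 * m * \<bar>e s\<bar> + m\<^sup>2)"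
    by (intro Bochner_Integration.integral_cong) (auto simp: power2_diff)
  also have "\<dots> = (LINT s|lebesgue_on {- 1..0}. (e s)\<^sup>2) - 2 * m * m + m\<^sup>2"
    using int int2 one by (simp add: m_def)
  finally have "m\<^sup>2 \<le> (LINT s|lebesgue_on {- 1..0}. (e s)\<^sup>2)" by (simp add: power2_eq_square)
  then have "m \<le> sqrt (LINT s|lebesgue_on {- 1..0}. (e s)\<^sup>2)" by (rule real_le_rsqrt)
  moreover have "\<bar>LINT s|lebesgue_on {- 1..0}. e s * \<psi> s\<bar> \<le> m"
    unfolding m_def
  proof (rule integral_abs_bound_integral[OF _ int])
    show le: "\<bar>e s * \<psi> s\<bar> \<le> \<bar>e s\<bar>" for s
      using \<psi>(2)[of s] by (simp add: abs_mult mult_left_le)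
    show "integrable (lebesgue_on {- 1..0}) (\<lambda>s. e s * \<psi> s)"
      by (rule Bochner_Integration.integrable_bound[OF int]) (use em \<psi> le in auto)
  qed
  ultimately show ?thesis by linarith
qed

section \<open>Pairing with test functions that move along characteristics\<close>

lemma L2_on_cmult: "L2_on S f \<Longrightarrow> L2_on S (\<lambda>s. c * f s)"
  by (auto simp: L2_on_def power_mult_distrib)

lemma L2_on_diff:
  assumes "L2_on S f" "L2_on S g"
  shows "L2_on S (\<lambda>s. f s - g s)"
proof -
  have m: "(\<lambda>s. f s - g s) \<in> borel_measurable (lebesgue_on S)"
    using assms by (auto simp: L2_on_def)
  have "integrable (lebesgue_on S) (\<lambda>s. 2 * (f s)\<^sup>2 + 2 * (g s)\<^sup>2)"
    using assms by (auto simp: L2_on_def)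
  then have "integrable (lebesgue_on S) (\<lambda>s. (f s - g s)\<^sup>2)"
  proof (rule Bochner_Integration.integrable_bound)
    show "(\<lambda>s. (f s - g s)\<^sup>2) \<in> borel_measurable (lebesgue_on S)" using m by auto
    show "AE s in lebesgue_on S. norm ((f s - g s)\<^sup>2) \<le> norm (2 * (f s)\<^sup>2 + 2 * (g s)\<^sup>2)"
      using square_sum_le[of "f _" "- g _"] by (intro AE_I2) simp
  qed
  then show ?thesis using m by (simp add: L2_on_def)
qed

lemma lipschitz_of_bounded_deriv:
  fixes \<psi> \<psi>' :: "real \<Rightarrow> real"
  assumes "\<And>s. (\<psi> has_real_derivative \<psi>' s) (at s)" "\<And>s. \<bar>\<psi>' s\<bar> \<le> L"
  shows "\<bar>\<psi> x - \<psi> y\<bar> \<le> L * \<bar>x - y\<bar>"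
  using field_differentiable_bound[of UNIV \<psi> \<psi>' L x y] assms by simp

lemma integrable_mult_continuous_Icc:
  fixes f \<psi> :: "real \<Rightarrow> real"
  assumes "integrable (lebesgue_on {a..b}) f" "continuous_on UNIV \<psi>" "\<And>s. \<bar>\<psi> s\<bar> \<le> B"
  shows "integrable (lebesgue_on {a..b}) (\<lambda>s. f s * \<psi> s)"
proof (rule Bochner_Integration.integrable_bound[of _ "\<lambda>s. B * f s"])
  have "\<psi> \<in> borel_measurable (lebesgue_on {a..b})"
    by (intro borel_measurable_lebesgue_on borel_measurable_continuous_onI assms)
  then show "(\<lambda>s. f s * \<psi> s) \<in> borel_measurable (lebesgue_on {a..b})"
    using assms(1) by auto
  have "\<bar>f s * \<psi> s\<bar> \<le> \<bar>B * f s\<bar>" for s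
    using mult_left_mono[OF assms(3)[of s], of "\<bar>f s\<bar>"] assms(3)[of s] by (auto simp: abs_mult mult.commute)
  then show "AE s in lebesgue_on {a..b}. norm (f s * \<psi> s) \<le> norm (B * f s)" by simp
qed (use assms in auto)

text \<open>Here f is frozen and time enters through the argument of the smooth \<psi>, which
  permits differentiation under the integral; 1/\<tau> is the inner derivative.\<close>

lemma moving_test_integral_deriv:
  fixes f \<psi> \<psi>' :: "real \<Rightarrow> real"
  assumes f: "continuous_on {- 1..0} f" and \<psi>: "\<And>s. (\<psi> has_real_derivative \<psi>' s) (at s)"
    and \<psi>': "continuous_on UNIV \<psi>'" and tau: "0 < \<tau>"
  shows "((\<lambda>t'. LINT s|lebesgue_on {- 1..0}. f s * \<psi> (s + (t' - t1) / \<tau>)) has_real_derivative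
    (LINT s|lebesgue_on {- 1..0}. f s * \<psi>' (s + (t - t1) / \<tau>)) / \<tau>) (at t within T)"
proof -
  have \<psi>c: "continuous_on UNIV \<psi>"
    by (rule DERIV_continuous_on) (use \<psi> in \<open>auto intro: has_field_derivative_at_within\<close>)
  have cont: "continuous_on {- 1..0} (\<lambda>s. f s * g (s + a))" if "continuous_on UNIV g" for g and a :: real
    by (intro continuous_on_mult f continuous_on_compose2[OF that] continuous_intros) auto
  have eq: "(LINT s|lebesgue_on {- 1..0}. f s * g (s + a)) = integral (cbox (- 1) 0) (\<lambda>s. f s * g (s + a))"
    if "continuous_on UNIV g" for g and a :: real
    using cont[OF that, of a] by (subst lebesgue_integral_eq_integral) (auto intro: continuous_imp_integrable_real)
  have "((\<lambda>t'. integral (cbox (- 1) 0) (\<lambda>s. f s * \<psi> (s + (t' - t1) / \<tau>))) has_real_derivative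
      integral (cbox (- 1) 0) (\<lambda>s. f s * (\<psi>' (s + (t - t1) / \<tau>) / \<tau>))) (at t within UNIV)"
  proof (rule leibniz_rule_field_derivative)
    show "((\<lambda>t'. f s * \<psi> (s + (t' - t1) / \<tau>)) has_real_derivative f s * (\<psi>' (s + (t' - t1) / \<tau>) / \<tau>))
        (at t' within UNIV)" for t' s
    proof -
      have "((\<lambda>t'. s + (t' - t1) / \<tau>) has_real_derivative 1 / \<tau>) (at t')"
        using tau by (auto intro!: derivative_eq_intros)
      from DERIV_cmult[OF DERIV_chain2[OF \<psi> this], of "f s"] show ?thesis by simp
    qed
    show "(\<lambda>s. f s * \<psi> (s + (t' - t1) / \<tau>)) integrable_on cbox (- 1) 0" for t'
      using cont[OF \<psi>c] by (intro integrable_continuous) simp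
    have "continuous_on (UNIV \<times> {- 1..0}) (\<lambda>x. \<psi>' (snd x + (fst x - t1) / \<tau>))"
      by (rule continuous_on_compose2[OF \<psi>']) (use tau in \<open>auto intro!: continuous_intros\<close>)
    moreover have "continuous_on (UNIV \<times> {- 1..0}) (\<lambda>x::real \<times> real. f (snd x))"
      by (rule continuous_on_compose2[OF f]) (auto intro!: continuous_intros)
    ultimately have "continuous_on (UNIV \<times> {- 1..0})
        (\<lambda>x. f (snd x) * (\<psi>' (snd x + (fst x - t1) / \<tau>) / \<tau>))"
      using tau by (intro continuous_on_mult continuous_on_divide continuous_on_const) auto
    then show "continuous_on (UNIV \<times> cbox (- 1) 0) (\<lambda>(t', s). f s * (\<psi>' (s + (t' - t1) / \<tau>) / \<tau>))"
      by (simp add: case_prod_beta')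
  qed auto
  then have "((\<lambda>t'. LINT s|lebesgue_on {- 1..0}. f s * \<psi> (s + (t' - t1) / \<tau>)) has_real_derivative
    (LINT s|lebesgue_on {- 1..0}. f s * \<psi>' (s + (t - t1) / \<tau>)) / \<tau>) (at t within UNIV)"
    by (simp add: eq[OF \<psi>c] eq[OF \<psi>'])
  then show ?thesis by (rule has_field_derivative_subset) simp
qed

text \<open>The scalar form of the transport equation that the uniqueness argument works with:
  continuity in s, differentiability in L2, and equality of the two derivatives almost
  everywhere.\<close>

definition L2_transport :: "real \<Rightarrow> (real \<Rightarrow> real \<Rightarrow> real) \<Rightarrow> bool" where
  "L2_transport \<tau> \<phi> \<longleftrightarrow>
     (\<forall>t\<ge>0. continuous_on {- 1..0} (\<phi> t) \<and> L2_on {- 1..0} (\<phi> t) \<and>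
       (\<exists>D G. L2_on {- 1..0} D \<and> L2_on {- 1..0} G \<and> has_weak_deriv {- 1..0} (\<phi> t) G \<and>
         (AE s in lebesgue_on {- 1..0}. D s = 1 / \<tau> * G s) \<and>
         ((\<lambda>t'. sqrt (LINT s|lebesgue_on {- 1..0}. (\<phi> t' s - \<phi> t s - (t' - t) * D s)\<^sup>2) / \<bar>t' - t\<bar>)
           \<longlongrightarrow> 0) (at t within {0..})))"

text \<open>Product rule for a factor differentiable in L2 and a smooth one. The increment splits
  into the remainder e, the D term, and the motion of the test with \<phi> frozen at t. The last two
  limits cancel, since D = G / \<tau> and the weak identity for G tested with \<open>P t\<close> has
  the opposite sign. At the reference time \<open>t1\<close> the test is not shifted.\<close>

lemma L2_transport_pairing_deriv:
  assumes tau: "0 < \<tau>" and \<phi>: "L2_transport \<tau> \<phi>" and t: "0 \<le> t"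
    and \<psi>: "\<And>s. (\<psi> has_real_derivative \<psi>' s) (at s)" "continuous_on UNIV \<psi>'"
    and bd: "\<And>s. \<bar>\<psi> s\<bar> \<le> 1" "\<And>s. \<bar>\<psi>' s\<bar> \<le> L"
    and supp: "compact C" "C \<subseteq> {- 1<..<0}" "\<And>s. s \<notin> C \<Longrightarrow> \<psi> (s + (t - t1) / \<tau>) = 0"
  shows "((\<lambda>t'. LINT s|lebesgue_on {- 1..0}. \<phi> t' s * \<psi> (s + (t' - t1) / \<tau>)) has_real_derivative 0)
    (at t within {0..})"
proof -
  obtain D G where \<phi>c: "continuous_on {- 1..0} (\<phi> t)" and \<phi>L: "L2_on {- 1..0} (\<phi> t)"
    and D: "L2_on {- 1..0} D" and G: "L2_on {- 1..0} G" and weak: "has_weak_deriv {- 1..0} (\<phi> t) G"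
    and DG: "AE s in lebesgue_on {- 1..0}. D s = 1 / \<tau> * G s"
    and lim: "((\<lambda>t'. sqrt (LINT s|lebesgue_on {- 1..0}. (\<phi> t' s - \<phi> t s - (t' - t) * D s)\<^sup>2) / \<bar>t' - t\<bar>)
           \<longlongrightarrow> 0) (at t within {0..})"
    using \<phi> t unfolding L2_transport_def by blast
  define P where "P = (\<lambda>t' s. \<psi> (s + (t' - t1) / \<tau>))"
  define e where "e = (\<lambda>t' s. \<phi> t' s - \<phi> t s - (t' - t) * D s)"
  have \<psi>c: "continuous_on UNIV \<psi>"
    by (rule DERIV_continuous_on) (use \<psi> in \<open>auto intro: has_field_derivative_at_within\<close>)
  have Pc: "continuous_on UNIV (P t')" for t'
    unfolding P_def by (rule continuous_on_compose2[OF \<psi>c]) (auto intro!: continuous_intros)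
  have Pm: "P t' \<in> borel_measurable (lebesgue_on {- 1..0})" for t'
    by (intro borel_measurable_lebesgue_on borel_measurable_continuous_onI Pc)
  have Pb: "\<bar>P t' s\<bar> \<le> 1" for t' s using bd by (simp add: P_def)
  note int = integrable_mult_continuous_Icc[OF _ Pc Pb]
  have Dint: "integrable (lebesgue_on {- 1..0}) D" by (rule L2_on_imp_integrable[OF D])
  have \<phi>int: "integrable (lebesgue_on {- 1..0}) (\<phi> t')" if "0 \<le> t'" for t'
    using \<phi> that by (intro L2_on_imp_integrable) (simp add: L2_transport_def)
  have eL: "L2_on {- 1..0} (e t')" if "0 \<le> t'" for t'
    unfolding e_def by (intro L2_on_diff L2_on_cmult \<phi>L D) (use \<phi> that in \<open>simp add: L2_transport_def\<close>)
  have eint: "integrable (lebesgue_on {- 1..0}) (e t')" if "0 \<le> t'" for t'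
    by (rule L2_on_imp_integrable[OF eL[OF that]])
  \<comment> \<open>The remainder is o(|t' - t|) in L2, hence also when paired with tests bounded by
    1.\<close>
  have A: "((\<lambda>t'. (LINT s|lebesgue_on {- 1..0}. e t' s * P t' s) / (t' - t)) \<longlongrightarrow> 0) (at t within {0..})"
  proof (rule Lim_null_comparison[OF _ lim])
    show "\<forall>\<^sub>F t' in at t within {0..}. norm ((LINT s|lebesgue_on {- 1..0}. e t' s * P t' s) / (t' - t))
      \<le> sqrt (LINT s|lebesgue_on {- 1..0}. (\<phi> t' s - \<phi> t s - (t' - t) * D s)\<^sup>2) / \<bar>t' - t\<bar>"
      unfolding eventually_at_filter
    proof (intro always_eventually allI impI)
      fix t' :: real assume "t' \<in> {0..}"
      then show "norm ((LINT s|lebesgue_on {- 1..0}. e t' s * P t' s) / (t' - t))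
        \<le> sqrt (LINT s|lebesgue_on {- 1..0}. (\<phi> t' s - \<phi> t s - (t' - t) * D s)\<^sup>2) / \<bar>t' - t\<bar>"
        using abs_integral_mult_le_L2[OF eL Pm Pb, of t' t']
        by (simp add: e_def divide_right_mono)
    qed
  qed
  have lip: "\<bar>P t' s - P t s\<bar> \<le> L / \<tau> * \<bar>t' - t\<bar>" for t' s
  proof -
    have "(s + (t' - t1) / \<tau>) - (s + (t - t1) / \<tau>) = (t' - t) / \<tau>" by (simp add: diff_divide_distrib)
    then show ?thesis
      using lipschitz_of_bounded_deriv[OF \<psi>(1) bd(2), of "s + (t' - t1) / \<tau>" "s + (t - t1) / \<tau>"] tau
      by (simp add: P_def)
  qed
  \<comment> \<open>The test is Lipschitz in t' with constant L / \<tau>, uniformly in s, so D may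
    be paired with the limit test.\<close>
  have B: "((\<lambda>t'. LINT s|lebesgue_on {- 1..0}. D s * P t' s) \<longlongrightarrow> (LINT s|lebesgue_on {- 1..0}. D s * P t s))
     (at t within {0..})"
  proof (rule LIM_zero_cancel, rule Lim_null_comparison)
    show "\<forall>\<^sub>F t' in at t within {0..}. norm ((LINT s|lebesgue_on {- 1..0}. D s * P t' s) -
        (LINT s|lebesgue_on {- 1..0}. D s * P t s)) \<le> (LINT s|lebesgue_on {- 1..0}. \<bar>D s\<bar>) * (L / \<tau>) * \<bar>t' - t\<bar>"
    proof (intro always_eventually allI)
      fix t'
      have "\<bar>LINT s|lebesgue_on {- 1..0}. D s * P t' s - D s * P t s\<bar> \<le>
          (LINT s|lebesgue_on {- 1..0}. \<bar>D s\<bar> * (L / \<tau> * \<bar>t' - t\<bar>))"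
      proof (rule integral_abs_bound_integral)
        show "\<bar>D s * P t' s - D s * P t s\<bar> \<le> \<bar>D s\<bar> * (L / \<tau> * \<bar>t' - t\<bar>)" for s
          using mult_left_mono[OF lip[of t' s], of "\<bar>D s\<bar>"]
          by (simp only: right_diff_distrib[symmetric] abs_mult abs_ge_zero)
      qed (use Dint int[OF Dint] in auto)
      then show "norm ((LINT s|lebesgue_on {- 1..0}. D s * P t' s) -
        (LINT s|lebesgue_on {- 1..0}. D s * P t s)) \<le> (LINT s|lebesgue_on {- 1..0}. \<bar>D s\<bar>) * (L / \<tau>) * \<bar>t' - t\<bar>"
        using int[OF Dint] by (simp add: mult.assoc)
    qed
    show "((\<lambda>t'. (LINT s|lebesgue_on {- 1..0}. \<bar>D s\<bar>) * (L / \<tau>) * \<bar>t' - t\<bar>) \<longlongrightarrow> 0) (at t within {0..})"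
      using tau by (auto intro!: tendsto_eq_intros)
  qed
  have C: "((\<lambda>t'. ((LINT s|lebesgue_on {- 1..0}. \<phi> t s * P t' s) - (LINT s|lebesgue_on {- 1..0}. \<phi> t s * P t s)) / (t' - t))
     \<longlongrightarrow> (LINT s|lebesgue_on {- 1..0}. \<phi> t s * \<psi>' (s + (t - t1) / \<tau>)) / \<tau>) (at t within {0..})"
    using moving_test_integral_deriv[OF \<phi>c \<psi> tau, of t1 t "{0..}"]
    unfolding has_field_derivative_iff P_def .
  have "(LINT s|lebesgue_on {- 1..0}. \<phi> t s * \<psi>' (s + (t - t1) / \<tau>)) = - (LINT s|lebesgue_on {- 1..0}. G s * P t s)"
  proof (rule has_weak_derivD[OF weak _ _ supp(1)])
    show "(P t has_real_derivative \<psi>' (s + (t - t1) / \<tau>)) (at s)" for s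
    proof -
      have "((\<lambda>s. s + (t - t1) / \<tau>) has_real_derivative 1) (at s)"
        by (auto intro!: derivative_eq_intros)
      from DERIV_chain2[OF \<psi>(1) this] show ?thesis by (simp add: P_def[abs_def])
    qed
    show "continuous_on UNIV (\<lambda>s. \<psi>' (s + (t - t1) / \<tau>))"
      by (rule continuous_on_compose2[OF \<psi>(2)]) (auto intro!: continuous_intros)
  qed (use supp in \<open>auto simp: P_def\<close>)
  moreover have "(LINT s|lebesgue_on {- 1..0}. D s * P t s) = (LINT s|lebesgue_on {- 1..0}. 1 / \<tau> * (G s * P t s))"
  proof (rule integral_cong_AE)
    show "AE s in lebesgue_on {- 1..0}. D s * P t s = 1 / \<tau> * (G s * P t s)"
      using DG by eventually_elim simp
  qed (use D G Pm in \<open>auto simp: L2_on_def\<close>)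
  ultimately have zero: "(LINT s|lebesgue_on {- 1..0}. D s * P t s) +
      (LINT s|lebesgue_on {- 1..0}. \<phi> t s * \<psi>' (s + (t - t1) / \<tau>)) / \<tau> = 0"
    by simp
  \<comment> \<open>Regroups the three quotients; a, b, c, d stand for the pairings of e, D and
    \<phi> at t with \<open>P t'\<close>, and of \<phi> at t with \<open>P t\<close>.\<close>
  have combine: "a / h + b + (c - d) / h = (a + h * b + c - d) / h" if "h \<noteq> 0" for a b c d h :: real
    using that by (simp add: field_simps)
  have "((\<lambda>t'. (LINT s|lebesgue_on {- 1..0}. e t' s * P t' s) / (t' - t) + (LINT s|lebesgue_on {- 1..0}. D s * P t' s) +
     ((LINT s|lebesgue_on {- 1..0}. \<phi> t s * P t' s) - (LINT s|lebesgue_on {- 1..0}. \<phi> t s * P t s)) / (t' - t))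
     \<longlongrightarrow> 0) (at t within {0..})"
    using tendsto_add[OF tendsto_add[OF A B] C] by (simp add: zero)
  then have "((\<lambda>t'. ((LINT s|lebesgue_on {- 1..0}. \<phi> t' s * P t' s) - (LINT s|lebesgue_on {- 1..0}. \<phi> t s * P t s)) / (t' - t))
     \<longlongrightarrow> 0) (at t within {0..})"
  proof (rule Lim_transform_eventually)
    show "\<forall>\<^sub>F t' in at t within {0..}. (LINT s|lebesgue_on {- 1..0}. e t' s * P t' s) / (t' - t) +
       (LINT s|lebesgue_on {- 1..0}. D s * P t' s) +
       ((LINT s|lebesgue_on {- 1..0}. \<phi> t s * P t' s) - (LINT s|lebesgue_on {- 1..0}. \<phi> t s * P t s)) / (t' - t) =
       ((LINT s|lebesgue_on {- 1..0}. \<phi> t' s * P t' s) - (LINT s|lebesgue_on {- 1..0}. \<phi> t s * P t s)) / (t' - t)"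
      unfolding eventually_at_filter
    proof (intro always_eventually allI impI)
      fix t' :: real assume t': "t' \<noteq> t" "t' \<in> {0..}"
      have "(LINT s|lebesgue_on {- 1..0}. \<phi> t' s * P t' s) =
         (LINT s|lebesgue_on {- 1..0}. e t' s * P t' s + (t' - t) * (D s * P t' s) + \<phi> t s * P t' s)"
        by (intro Bochner_Integration.integral_cong) (auto simp: e_def algebra_simps)
      also have "\<dots> = (LINT s|lebesgue_on {- 1..0}. e t' s * P t' s) +
         (t' - t) * (LINT s|lebesgue_on {- 1..0}. D s * P t' s) + (LINT s|lebesgue_on {- 1..0}. \<phi> t s * P t' s)"
        using int[OF eint, of t' t'] int[OF Dint, of t'] int[OF \<phi>int[OF t], of t'] t' by simp
      finally show "(LINT s|lebesgue_on {- 1..0}. e t' s * P t' s) / (t' - t) +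
       (LINT s|lebesgue_on {- 1..0}. D s * P t' s) +
       ((LINT s|lebesgue_on {- 1..0}. \<phi> t s * P t' s) - (LINT s|lebesgue_on {- 1..0}. \<phi> t s * P t s)) / (t' - t) =
       ((LINT s|lebesgue_on {- 1..0}. \<phi> t' s * P t' s) - (LINT s|lebesgue_on {- 1..0}. \<phi> t s * P t s)) / (t' - t)"
        using combine[of "t' - t"] t' by simp
    qed
  qed
  then show ?thesis by (simp add: has_field_derivative_iff P_def)
qed

text \<open>From t1 to t2 the enclosing interval [c,d+e] of the support slides left by (t2 - t1) /
  \<tau>. The conditions on c, d and e say that its extreme positions, hence all between, stay
  inside (-1,0).\<close>

lemma L2_transport_window:
  assumes tau: "0 < \<tau>" and \<phi>: "L2_transport \<tau> \<phi>" and t: "0 \<le> t1" "t1 \<le> t2"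
    and cd: "(t2 - t1) / \<tau> - 1 < c" "c \<le> d" "d + e < 0" "0 < e"
  shows "(LINT s|lebesgue_on {- 1..0}. \<phi> t2 s * window (c - (t2 - t1) / \<tau>) (d - (t2 - t1) / \<tau>) e s) =
    (LINT s|lebesgue_on {- 1..0}. \<phi> t1 s * window c d e s)"
proof -
  have "\<exists>k. \<forall>t\<in>{t1..t2}. (LINT s|lebesgue_on {- 1..0}. \<phi> t s * window c d e (s + (t - t1) / \<tau>)) = k"
  proof (rule has_field_derivative_zero_constant)
    fix t assume tt: "t \<in> {t1..t2}"
    let ?a = "(t - t1) / \<tau>"
    have a: "0 \<le> ?a" "?a \<le> (t2 - t1) / \<tau>" using tt tau by (auto simp: divide_right_mono)
    \<comment> \<open>Both scaled triangles take values in [0, 2 / e], so their difference obeys the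
      same bound.\<close>
    have bd': "\<bar>window' c d e s\<bar> \<le> 2 / e" for s
    proof -
      have "0 \<le> hat ((s - p) / e) / e" "hat ((s - p) / e) / e \<le> 2 / e" for p
        using hat_bounds[of "(s - p) / e"] \<open>0 < e\<close> by (auto intro: divide_right_mono)
      from this[of c] this[of d] show ?thesis by (simp add: window'_def)
    qed
    have "((\<lambda>t'. LINT s|lebesgue_on {- 1..0}. \<phi> t' s * window c d e (s + (t' - t1) / \<tau>)) has_real_derivative 0)
      (at t within {0..})"
    proof (rule L2_transport_pairing_deriv[OF tau \<phi> _ window_deriv continuous_window' abs_window_le bd'])
      show "{c - ?a..d + e - ?a} \<subseteq> {- 1<..<0}" using a cd by auto
      show "window c d e (s + ?a) = 0" if "s \<notin> {c - ?a..d + e - ?a}" for s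
        by (rule window_eq_0) (use that cd in auto)
    qed (use tt t in auto)
    then show "((\<lambda>t'. LINT s|lebesgue_on {- 1..0}. \<phi> t' s * window c d e (s + (t' - t1) / \<tau>)) has_real_derivative 0)
      (at t within {t1..t2})"
      by (rule has_field_derivative_subset) (use t in auto)
  qed simp
  then obtain k where k: "\<And>t. t \<in> {t1..t2} \<Longrightarrow>
      (LINT s|lebesgue_on {- 1..0}. \<phi> t s * window c d e (s + (t - t1) / \<tau>)) = k"
    by blast
  have "window c d e (s + a) = window (c - a) (d - a) e s" for s a
    by (simp add: window_def algebra_simps)
  with k[of t1] k[of t2] t show ?thesis by simp
qed

text \<open>The integral over [c,u] vanishes for all u near an interior y, and its derivative at y
  is f y. The boundary points follow by continuity.\<close>

lemma eq_0_if_integrals_eq_0: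
  fixes f :: "real \<Rightarrow> real"
  assumes ab: "a < b" and f: "continuous_on {a..b} f"
    and int: "\<And>c d. a < c \<Longrightarrow> c \<le> d \<Longrightarrow> d < b \<Longrightarrow> integral {c..d} f = 0" and x: "x \<in> {a..b}"
  shows "f x = 0"
proof -
  have "f y = 0" if y: "y \<in> {a<..<b}" for y
  proof -
    define c d where "c = (a + y) / 2" and "d = (y + b) / 2"
    have cd: "a < c" "c < y" "y < d" "d < b" using y by (auto simp: c_def d_def field_simps)
    have "((\<lambda>u. integral {c..u} f) has_vector_derivative f y) (at y within {c..d})"
      by (rule integral_has_vector_derivative) (use cd in \<open>auto intro: continuous_on_subset[OF f]\<close>)
    moreover have "((\<lambda>u. integral {c..u} f) has_vector_derivative 0) (at y within {c..d})"
      by (rule has_vector_derivative_transform[where f = "\<lambda>_. 0"]) (use cd int in auto)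
    ultimately show ?thesis
      using vector_derivative_unique_within_closed_interval[of c d y "\<lambda>u. integral {c..u} f" "f y" 0] cd
      by simp
  qed
  moreover have "closure {a<..<b} = {a..b}" using ab by simp
  ultimately show ?thesis
    using continuous_constant_on_closure[of "{a<..<b}" f 0 x] f x by simp
qed

text \<open>Shrinking the flanks turns the conserved pairings into equality of the integrals over
  [c - \<delta>, d - \<delta>] at t2 and over [c,d] at t1; continuity makes it pointwise. For
  \<delta> < 1 the interval [\<delta> - 1, 0] of admissible x is nondegenerate.\<close>

lemma L2_transport_step:
  assumes tau: "0 < \<tau>" and \<phi>: "L2_transport \<tau> \<phi>" and t: "0 \<le> t1" "t1 \<le> t2"
    and \<delta>: "\<delta> = (t2 - t1) / \<tau>" "\<delta> < 1" and x: "x \<in> {\<delta> - 1..0}"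
  shows "\<phi> t2 (x - \<delta>) = \<phi> t1 x"
proof -
  have \<phi>c: "continuous_on {- 1..0} (\<phi> t)" and \<phi>int: "integrable (lebesgue_on {- 1..0}) (\<phi> t)" if "0 \<le> t" for t
    using \<phi> that by (auto simp: L2_transport_def intro: L2_on_imp_integrable)
  have t2: "0 \<le> t2" using t by simp
  have \<delta>0: "0 \<le> \<delta>" using t tau \<delta> by simp
  have c2: "continuous_on {\<delta> - 1..0} (\<lambda>x. \<phi> t2 (x - \<delta>))"
    by (rule continuous_on_compose2[OF \<phi>c[OF t2]]) (use \<delta>0 in \<open>auto intro!: continuous_intros\<close>)
  have c1: "continuous_on {\<delta> - 1..0} (\<phi> t1)"
    by (rule continuous_on_subset[OF \<phi>c[OF t(1)]]) (use \<delta>0 in auto)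
  have "\<phi> t2 (x - \<delta>) - \<phi> t1 x = 0"
  proof (rule eq_0_if_integrals_eq_0[OF _ _ _ x])
    show "continuous_on {\<delta> - 1..0} (\<lambda>x. \<phi> t2 (x - \<delta>) - \<phi> t1 x)"
      by (intro continuous_on_diff c1 c2)
    fix c d :: real assume cd: "\<delta> - 1 < c" "c \<le> d" "d < 0"
    \<comment> \<open>Then d + e = d / 2 < 0, so the falling flank stops short of s = 0.\<close>
    define e where "e = - d / 2"
    have e: "0 < e" "d + e < 0" using cd by (auto simp: e_def)
    have "(LINT s|lebesgue_on {- 1..0}. \<phi> t2 s * window (c - \<delta>) (d - \<delta>) (e / real (Suc n)) s) =
        (LINT s|lebesgue_on {- 1..0}. \<phi> t1 s * window c d (e / real (Suc n)) s)" for n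
    proof -
      have "0 < e / real (Suc n)" "e / real (Suc n) \<le> e" using e by (auto simp: field_simps)
      then show ?thesis
        unfolding \<delta>(1) by (intro L2_transport_window[OF tau \<phi> t]) (use cd e \<delta>(1) in auto)
    qed
    then have "(\<lambda>n. LINT s|lebesgue_on {- 1..0}. \<phi> t1 s * window c d (e / real (Suc n)) s)
        \<longlonglongrightarrow> (LINT s|lebesgue_on {- 1..0}. \<phi> t2 s * indicat_real {c - \<delta><..d - \<delta>} s)"
      using integral_window_tendsto[OF \<phi>int[OF t2] e(1), of "c - \<delta>" "d - \<delta>"] cd by simp
    then have "(LINT s|lebesgue_on {- 1..0}. \<phi> t2 s * indicat_real {c - \<delta><..d - \<delta>} s) =
        (LINT s|lebesgue_on {- 1..0}. \<phi> t1 s * indicat_real {c<..d} s)"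
      by (rule LIMSEQ_unique[OF _ integral_window_tendsto[OF \<phi>int[OF t(1)] e(1) cd(2)]])
    then have "integral {c - \<delta>..d - \<delta>} (\<phi> t2) = integral {c..d} (\<phi> t1)"
      using integral_mult_indicator_Ioc[OF \<phi>int[OF t2], of "c - \<delta>" "d - \<delta>"]
        integral_mult_indicator_Ioc[OF \<phi>int[OF t(1)], of c d] cd \<delta>0 by simp
    moreover have "integral {c..d} (\<lambda>x. \<phi> t2 (x - \<delta>)) = integral {c - \<delta>..d - \<delta>} (\<phi> t2)"
      using integral_shift_Icc_real[of "c - \<delta>" "d - \<delta>" "\<lambda>x. \<phi> t2 (x - \<delta>)" \<delta>] by (simp add: o_def)
    moreover have "integral {c..d} (\<lambda>x. \<phi> t2 (x - \<delta>) - \<phi> t1 x) =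
        integral {c..d} (\<lambda>x. \<phi> t2 (x - \<delta>)) - integral {c..d} (\<phi> t1)"
      by (intro Henstock_Kurzweil_Integration.integral_diff integrable_continuous_real
          continuous_on_subset[OF c1] continuous_on_subset[OF c2]) (use cd in auto)
    ultimately show "integral {c..d} (\<lambda>x. \<phi> t2 (x - \<delta>) - \<phi> t1 x) = 0" by simp
  qed (use \<delta> in simp)
  then show ?thesis by simp
qed

text \<open>Back in time from (t,s) the characteristic moves towards s = 0. It meets that boundary
  at time t + \<tau> s if this is nonnegative, and otherwise the initial line at s + t /
  \<tau>.\<close>

lemma L2_transport_characteristics:
  assumes tau: "0 < \<tau>" and \<phi>: "L2_transport \<tau> \<phi>" and t: "0 \<le> t" and s: "s \<in> {- 1..0}"
  shows "\<phi> t s = (if 0 \<le> t + \<tau> * s then \<phi> (t + \<tau> * s) 0 else \<phi> 0 ((t + \<tau> * s) / \<tau>))"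
proof (cases "0 \<le> t + \<tau> * s")
  case True
  show ?thesis
  proof (cases "s = - 1")
    case False
    have "\<phi> t (0 - (- s)) = \<phi> (t + \<tau> * s) 0"
      by (rule L2_transport_step[OF tau \<phi> True])
         (use s tau False in \<open>auto simp: mult_nonneg_nonpos\<close>)
    then show ?thesis using True by simp
  next
    \<comment> \<open>A full delay would be \<delta> = 1, which a single step excludes; two steps
      with \<delta> = 1/2 replace it.\<close>
    case s1: True
    have "\<phi> t (- 1 / 2 - 1 / 2) = \<phi> (t - \<tau> / 2) (- 1 / 2)"
      by (rule L2_transport_step[OF tau \<phi>]) (use tau True s1 in \<open>auto simp: field_simps\<close>)
    moreover have "\<phi> (t - \<tau> / 2) (0 - 1 / 2) = \<phi> (t - \<tau>) 0"
      by (rule L2_transport_step[OF tau \<phi>]) (use tau True s1 in \<open>auto simp: field_simps\<close>)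
    ultimately show ?thesis using True s1 by simp
  qed
next
  case False
  have 1: "t / \<tau> < - s" using False tau by (simp add: field_simps)
  have lt1: "t / \<tau> < 1" using 1 s by simp
  have 2: "(t + \<tau> * s) / \<tau> = s + t / \<tau>" using tau by (simp add: field_simps)
  have "\<phi> t (s + t / \<tau> - t / \<tau>) = \<phi> 0 (s + t / \<tau>)"
    by (rule L2_transport_step[OF tau \<phi>]) (use s t tau 1 lt1 in \<open>simp_all del: divide_less_eq_1_pos\<close>)
  then show ?thesis using False 2 by simp
qed

section \<open>Transfer to the vector system\<close>

lemma W12_on_cong:
  assumes "\<And>s. s \<in> S \<Longrightarrow> f s = g s" and S: "S \<in> sets lebesgue"
  shows "W12_on S f \<longleftrightarrow> W12_on S g"
proof -
  have "f \<in> borel_measurable (lebesgue_on S) \<longleftrightarrow> g \<in> borel_measurable (lebesgue_on S)"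
    by (rule measurable_cong) (use assms in auto)
  moreover have "integrable (lebesgue_on S) (\<lambda>s. (f s)\<^sup>2) \<longleftrightarrow> integrable (lebesgue_on S) (\<lambda>s. (g s)\<^sup>2)"
    by (rule Bochner_Integration.integrable_cong) (use assms in auto)
  moreover have "continuous_on S f \<longleftrightarrow> continuous_on S g"
    by (rule continuous_on_cong) (use assms in auto)
  moreover have "(LINT s|lebesgue_on S. f s * \<psi> s) = (LINT s|lebesgue_on S. g s * \<psi> s)" for \<psi>
    by (rule Bochner_Integration.integral_cong) (use assms in auto)
  ultimately show ?thesis
    unfolding W12_on_def L2_on_def has_weak_deriv_def by simp
qed

text \<open>One square is below the sum of squares. A non-integrable sum would have Bochner integral
  0, so the comparison uses square integrability of all components.\<close>

lemma has_L2_derivative_component: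
  assumes der: "has_L2_derivative d S \<phi> D t" and k: "k < d" and "0 \<le> t"
    and L2: "\<And>t' k. 0 \<le> t' \<Longrightarrow> k < d \<Longrightarrow> L2_on S (\<lambda>s. \<phi> t' s k)"
  shows "((\<lambda>t'. sqrt (LINT s|lebesgue_on S. (\<phi> t' s k - \<phi> t s k - (t' - t) * D s k)\<^sup>2) / \<bar>t' - t\<bar>)
    \<longlongrightarrow> 0) (at t within {0..})"
proof (rule Lim_null_comparison)
  show "((\<lambda>t'. L2_norm d S (\<lambda>s k. \<phi> t' s k - \<phi> t s k - (t' - t) * D s k) / \<bar>t' - t\<bar>) \<longlongrightarrow> 0)
      (at t within {0..})"
    using der by (simp add: has_L2_derivative_def)
  have D: "L2_on S (\<lambda>s. D s k)" if "k < d" for k using der that by (simp add: has_L2_derivative_def)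
  show "\<forall>\<^sub>F t' in at t within {0..}.
      norm (sqrt (LINT s|lebesgue_on S. (\<phi> t' s k - \<phi> t s k - (t' - t) * D s k)\<^sup>2) / \<bar>t' - t\<bar>)
      \<le> L2_norm d S (\<lambda>s k. \<phi> t' s k - \<phi> t s k - (t' - t) * D s k) / \<bar>t' - t\<bar>"
    unfolding eventually_at_filter
  proof (intro always_eventually allI impI)
    fix t' :: real assume "t' \<in> {0..}"
    let ?e = "\<lambda>k s. \<phi> t' s k - \<phi> t s k - (t' - t) * D s k"
    have e: "integrable (lebesgue_on S) (\<lambda>s. (?e k s)\<^sup>2)" if "k < d" for k
      using L2_on_diff[OF L2_on_diff[OF L2[OF _ that] L2[OF \<open>0 \<le> t\<close> that]] L2_on_cmult[OF D[OF that]], of t']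
        \<open>t' \<in> {0..}\<close> by (simp add: L2_on_def)
    have "(LINT s|lebesgue_on S. (?e k s)\<^sup>2) \<le> (LINT s|lebesgue_on S. (\<Sum>k<d. (?e k s)\<^sup>2))"
    proof (rule integral_mono)
      show "(?e k s)\<^sup>2 \<le> (\<Sum>k<d. (?e k s)\<^sup>2)" for s
        using k by (intro member_le_sum) auto
    qed (use e k in auto)
    moreover have "0 \<le> (LINT s|lebesgue_on S. (?e k s)\<^sup>2)"
      by (intro integral_nonneg_AE AE_I2) simp
    ultimately show "norm (sqrt (LINT s|lebesgue_on S. (?e k s)\<^sup>2) / \<bar>t' - t\<bar>)
      \<le> L2_norm d S (\<lambda>s k. ?e k s) / \<bar>t' - t\<bar>"
      by (simp add: L2_norm_def divide_right_mono)
  qed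
qed

theorem satisfies_ODE_PDE_imp_DDF:
  assumes tau: "\<forall>i\<in>{1..K S}. 0 < tau S i" and pde: "satisfies_ODE_PDE S u w x0 \<phi>0 x \<phi> v y z"
  shows "satisfies_DDF S u w x0 (\<lambda>i s. \<phi>0 i (s / tau S i)) x
    (\<lambda>i t. if t \<ge> 0 then \<phi> i t 0 else \<phi>0 i (t / tau S i)) v y z"
    (is "satisfies_DDF S u w x0 ?ini x ?r v y z")
proof -
  have \<phi>0: "\<And>i k. i \<in> {1..K S} \<Longrightarrow> k < dimr S i \<Longrightarrow> W12_on {- 1..0} (\<lambda>s. \<phi>0 i s k) \<and>
        \<phi>0 i 0 k = mult_rows (Cr S i) x0 k + mult_rows (Drv S i) (pde_delay S \<phi>0) k"
    and init: "\<And>i s k. i \<in> {1..K S} \<Longrightarrow> s \<in> {- 1..0} \<Longrightarrow> k < dimr S i \<Longrightarrow> \<phi> i 0 s k = \<phi>0 i s k"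
    and W: "\<And>t i k. 0 \<le> t \<Longrightarrow> i \<in> {1..K S} \<Longrightarrow> k < dimr S i \<Longrightarrow> W12_on {- 1..0} (\<lambda>s. \<phi> i t s k)"
    and v: "\<And>t. 0 \<le> t \<Longrightarrow> v t = pde_delay S (\<lambda>i. \<phi> i t)"
    and evol: "\<And>t i. 0 \<le> t \<Longrightarrow> i \<in> {1..K S} \<Longrightarrow> \<exists>D G.
        has_L2_derivative (dimr S i) {- 1..0} (\<phi> i) D t \<and>
        (\<forall>k<dimr S i. L2_on {- 1..0} (\<lambda>s. G s k) \<and>
           has_weak_deriv {- 1..0} (\<lambda>s. \<phi> i t s k) (\<lambda>s. G s k)) \<and>
        (AE s in lebesgue_on {- 1..0}. \<forall>k<dimr S i. D s k = 1 / tau S i * G s k)"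
    and rest: "x 0 = x0" "block_equation S u w x (\<lambda>i t. \<phi> i t 0) v y z"
    using pde unfolding satisfies_ODE_PDE_def by blast+
  have transport: "L2_transport (tau S i) (\<lambda>t s. \<phi> i t s k)"
    if i: "i \<in> {1..K S}" and k: "k < dimr S i" for i k
    unfolding L2_transport_def
  proof (intro allI impI conjI)
    fix t :: real assume t: "0 \<le> t"
    show "continuous_on {- 1..0} (\<lambda>s. \<phi> i t s k)" "L2_on {- 1..0} (\<lambda>s. \<phi> i t s k)"
      using W[OF t i k] by (auto simp: W12_on_def)
    obtain D G where DG: "has_L2_derivative (dimr S i) {- 1..0} (\<phi> i) D t"
      "\<forall>k<dimr S i. L2_on {- 1..0} (\<lambda>s. G s k) \<and> has_weak_deriv {- 1..0} (\<lambda>s. \<phi> i t s k) (\<lambda>s. G s k)"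
      "AE s in lebesgue_on {- 1..0}. \<forall>k<dimr S i. D s k = 1 / tau S i * G s k"
      using evol[OF t i] by blast
    have "((\<lambda>t'. sqrt (LINT s|lebesgue_on {- 1..0}. (\<phi> i t' s k - \<phi> i t s k - (t' - t) * D s k)\<^sup>2) / \<bar>t' - t\<bar>)
      \<longlongrightarrow> 0) (at t within {0..})"
      by (rule has_L2_derivative_component[OF DG(1) k t]) (use W i in \<open>auto simp: W12_on_def\<close>)
    moreover have "AE s in lebesgue_on {- 1..0}. D s k = 1 / tau S i * G s k"
      using DG(3) k by (auto elim: eventually_mono)
    moreover have "L2_on {- 1..0} (\<lambda>s. D s k)"
      using DG(1) k by (simp add: has_L2_derivative_def)
    ultimately show "\<exists>D G. L2_on {- 1..0} D \<and> L2_on {- 1..0} G \<and> has_weak_deriv {- 1..0} (\<lambda>s. \<phi> i t s k) G \<and>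
         (AE s in lebesgue_on {- 1..0}. D s = 1 / tau S i * G s) \<and>
         ((\<lambda>t'. sqrt (LINT s|lebesgue_on {- 1..0}. (\<phi> i t' s k - \<phi> i t s k - (t' - t) * D s)\<^sup>2) / \<bar>t' - t\<bar>)
           \<longlongrightarrow> 0) (at t within {0..})"
      using DG(2) k by blast
  qed
  \<comment> \<open>This identity turns windows of \<open>?r\<close> into rescaled states, which
    yields their regularity and the delay term. For negative arguments the history enters through
    the initial condition on \<open>\<phi> i 0\<close>.\<close>
  have char: "?r i (t + tau S i * s) k = \<phi> i t s k"
    if t: "0 \<le> t" and i: "i \<in> {1..K S}" and s: "s \<in> {- 1..0}" and k: "k < dimr S i" for t i s k
  proof -
    have taui: "0 < tau S i" using tau i by auto
    have "\<phi> i t s k = (if 0 \<le> t + tau S i * s then \<phi> i (t + tau S i * s) 0 k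
        else \<phi> i 0 ((t + tau S i * s) / tau S i) k)"
      using L2_transport_characteristics[OF taui transport[OF i k] t s] .
    moreover have "(t + tau S i * s) / tau S i \<in> {- 1..0}" if "\<not> 0 \<le> t + tau S i * s"
    proof -
      have "(t + tau S i * s) / tau S i = t / tau S i + s" using taui by (simp add: field_simps)
      moreover have "(t + tau S i * s) / tau S i \<le> 0" using that taui by (intro divide_nonpos_pos) auto
      moreover have "0 \<le> t / tau S i" using t taui by simp
      ultimately show ?thesis using s unfolding atLeastAtMost_iff by linarith
    qed
    ultimately show ?thesis using init[OF i _ k] by (auto split: if_splits)
  qed
  have scale: "W12_on {- tau S i..0} (\<lambda>s. f (s / tau S i))"
    if "i \<in> {1..K S}" "W12_on {- 1..0} f" for i f
    using W12_on_affine_Icc[of "1 / tau S i" 0 "- tau S i" 0 f] that tau by auto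
  have in_range: "s / tau S i \<in> {- 1..0}" if "i \<in> {1..K S}" "s \<in> {- tau S i..0}" for i s
    using that tau by (auto simp: field_simps divide_nonpos_pos)
  have "W12_on {- tau S i..0} (\<lambda>s. ?r i (t + s) k)"
    if t: "0 \<le> t" and i: "i \<in> {1..K S}" and k: "k < dimr S i" for t i k
  proof -
    have taui: "0 < tau S i" using tau i by auto
    have "tau S i * (s / tau S i) = s" for s using taui by simp
    \<comment> \<open>\<open>char\<close> is applied at s / \<tau>_i; agreement is limited to the
      window, hence the congruence rule for \<open>W12_on\<close>.\<close>
    then have "?r i (t + s) k = \<phi> i t (s / tau S i) k" if "s \<in> {- tau S i..0}" for s
      using char[OF t i in_range[OF i that] k] by (simp only:)
    then show ?thesis
      using W12_on_cong[of "{- tau S i..0}" "\<lambda>s. ?r i (t + s) k" "\<lambda>s. \<phi> i t (s / tau S i) k"]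
        scale[OF i W[OF t i k]] by simp
  qed
  moreover have "v t = ddf_delay S (\<lambda>i s. ?r i (t + s))" if "0 \<le> t" for t
    unfolding v[OF that] by (rule ddf_delay_rescale[OF tau, symmetric]) (rule char[OF that])
  moreover have "ddf_delay S ?ini = pde_delay S \<phi>0"
  proof (rule ddf_delay_rescale[OF tau])
    fix i s k assume "i \<in> {1..K S}"
    then have "tau S i \<noteq> 0" using tau by force
    then show "?ini i (tau S i * s) k = \<phi>0 i s k" by simp
  qed
  then have "W12_on {- tau S i..0} (\<lambda>s. ?ini i s k) \<and>
      ?ini i 0 k = mult_rows (Cr S i) x0 k + mult_rows (Drv S i) (ddf_delay S ?ini) k"
    if "i \<in> {1..K S}" "k < dimr S i" for i k
    using \<phi>0[OF that] scale[OF that(1), of "\<lambda>s. \<phi>0 i s k"] by simp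
  \<comment> \<open>For s < 0 both sides coincide by definition; at s = 0 the left side is the trace
    of \<open>\<phi> i 0\<close>, fixed by the initial condition.\<close>
  moreover have "?r i s k = ?ini i s k"
    if "i \<in> {1..K S}" "s \<in> {- tau S i..0}" "k < dimr S i" for i s k
    using that init[OF that(1) _ that(3), of 0] by auto
  moreover have "block_equation S u w x ?r v y z"
    using rest(2) by (simp add: block_equation_def)
  ultimately show ?thesis
    using rest(1) unfolding satisfies_DDF_def by blast
qed

theorem lemma3:
  fixes S :: "('n::finite, 'm::finite, 'p::finite, 'q::finite, 'r::finite, 'nv::finite) delay_data"
    and u :: "real \<Rightarrow> real ^ 'p" and w :: "real \<Rightarrow> real ^ 'm"
  assumes "\<forall>i\<in>{1..K S}. 0 < tau S i"
    and "strict_mono_on {1..K S} (tau S)"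
    and "\<forall>i\<in>{1..K S}. \<forall>k<dimr S i. bounded ((\<lambda>s. Cvd S i s k) ` {- tau S i..0})"
    and "\<forall>j. L2_on {0..} (\<lambda>t. u t $ j)"
    and "\<forall>j. L2_on {0..} (\<lambda>t. w t $ j)"
    and "(\<exists>i\<in>{1..K S}. \<exists>k<dimr S i. Br1 S i k \<noteq> 0) \<longrightarrow>
           (\<forall>j. W12_on {0..} (\<lambda>t. w t $ j)) \<and> (\<forall>s\<le>0. w s = 0)"
    and "(\<exists>i\<in>{1..K S}. \<exists>k<dimr S i. Br2 S i k \<noteq> 0) \<longrightarrow>
           (\<forall>j. W12_on {0..} (\<lambda>t. u t $ j)) \<and> (\<forall>s\<le>0. u s = 0)"
  shows "(\<forall>x0 r0 x r v y z.
            satisfies_DDF S u w x0 r0 x r v y z \<longrightarrow>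
            satisfies_ODE_PDE S u w x0 (\<lambda>i s. r0 i (tau S i * s)) x
              (\<lambda>i t s. r i (t + tau S i * s)) v y z) \<and>
         (\<forall>x0 \<phi>0 x \<phi> v y z.
            satisfies_ODE_PDE S u w x0 \<phi>0 x \<phi> v y z \<longrightarrow>
            satisfies_DDF S u w x0 (\<lambda>i s. \<phi>0 i (s / tau S i)) x
              (\<lambda>i t. if t \<ge> 0 then \<phi> i t 0 else \<phi>0 i (t / tau S i)) v y z)"
  using satisfies_DDF_imp_ODE_PDE[OF assms(1)] satisfies_ODE_PDE_imp_DDF[OF assms(1)] by blast

end
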